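(* Let $n\ge 1$ and $f\in C_b^\infty(\mathbb{R}^n)$ (smooth, bounded, with all derivatives bounded). Define $u(t,x)=E_x[f(Z_t)]$ for $t\ge 0$, $x\in\mathbb{R}^n$, where $Z$ is $n$-dimensional iterated Brownian motion started at $x$. Then $u\in C^\infty((0,\infty)\times\mathbb{R}^n)\cap C_b([0,\infty)\times\mathbb{R}^n)$ and $u$ solves the Cauchy problem $$\Big(\tfrac18\Delta^2-\tfrac{\partial}{\partial t}\Big)u(t,x)=-\frac12\,\frac{1}{\sqrt{2\pi t}}\,\Delta f(x)\quad\text{on }(0,\infty)\times\mathbb{R}^n,\qquad u(0,x)=f(x),$$ where $\Delta$ is the Laplacian in $x$.
   Context: Let $X^+_t,X^-_t$ be independent $n$-dimensional Brownian motions started at $0$ and $Y_t$ an independent one-dimensional Brownian motion started at $0$. Two-sided Brownian motion is $X_t=X^+_t$ for $t\ge0$ and $X_t=X^-_{-t}$ for $t<0$. Iterated Brownian motion started at $z\in\mathbb{R}^n$ is $Z_t=z+X(Y_t)$, $t\ge0$; $P_z,E_z$ denote probability and expectation for $Z_0=z$. *)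

theory Defs
  imports "HOL-Probability.Probability"
begin

definition gauss_dens :: "real \<Rightarrow> 'b::euclidean_space \<Rightarrow> real" where
  "gauss_dens s y = (2 * pi * s) powr (- real DIM('b) / 2) * exp (- ((norm y) ^ 2) / (2 * s))"

definition is_BM :: "'a measure \<Rightarrow> (real \<Rightarrow> 'a \<Rightarrow> 'b::euclidean_space) \<Rightarrow> bool" where
  "is_BM M B \<longleftrightarrow>
     prob_space M \<and>
     (\<forall>t\<ge>0. B t \<in> borel_measurable M) \<and>
     (\<forall>\<omega>\<in>space M. B 0 \<omega> = 0 \<and> continuous_on {0..} (\<lambda>t. B t \<omega>)) \<and>
     (\<forall>s t. 0 \<le> s \<and> s < t \<longrightarrow>
        distributed M lborel (\<lambda>\<omega>. B t \<omega> - B s \<omega>) (\<lambda>y. ennreal (gauss_dens (t - s) y))) \<and>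
     (\<forall>(ts :: nat \<Rightarrow> real) k. 0 \<le> ts 0 \<and> (\<forall>i<k. ts i < ts (Suc i)) \<longrightarrow>
        prob_space.indep_vars M (\<lambda>_. borel) (\<lambda>i \<omega>. B (ts (Suc i)) \<omega> - B (ts i) \<omega>) {..<k})"

definition proc_sigma :: "'a measure \<Rightarrow> (real \<Rightarrow> 'a \<Rightarrow> 'b::topological_space) \<Rightarrow> 'a set set" where
  "proc_sigma M B = sigma_sets (space M) {B t -` A \<inter> space M | t A. 0 \<le> t \<and> A \<in> sets borel}"

definition two_sided :: "(real \<Rightarrow> 'a \<Rightarrow> 'b) \<Rightarrow> (real \<Rightarrow> 'a \<Rightarrow> 'b) \<Rightarrow> real \<Rightarrow> 'a \<Rightarrow> 'b" where
  "two_sided Xp Xm s \<omega> = (if 0 \<le> s then Xp s \<omega> else Xm (- s) \<omega>)"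

definition IBM :: "(real \<Rightarrow> 'a \<Rightarrow> 'b::real_vector) \<Rightarrow> (real \<Rightarrow> 'a \<Rightarrow> 'b) \<Rightarrow> (real \<Rightarrow> 'a \<Rightarrow> real)
                   \<Rightarrow> 'b \<Rightarrow> real \<Rightarrow> 'a \<Rightarrow> 'b" where
  "IBM Xp Xm Y z t \<omega> = z + two_sided Xp Xm (Y t \<omega>) \<omega>"

definition dd :: "('e::real_normed_vector \<Rightarrow> real) \<Rightarrow> 'e \<Rightarrow> 'e \<Rightarrow> real" where
  "dd g v x = deriv (\<lambda>s. g (x + s *\<^sub>R v)) 0"

fun pd_iter :: "'e::real_normed_vector list \<Rightarrow> ('e \<Rightarrow> real) \<Rightarrow> 'e \<Rightarrow> real" where
  "pd_iter [] g = g"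
| "pd_iter (v # vs) g = dd (pd_iter vs g) v"

definition smooth_on :: "'e::euclidean_space set \<Rightarrow> ('e \<Rightarrow> real) \<Rightarrow> bool" where
  "smooth_on U g \<longleftrightarrow>
     (\<forall>vs. set vs \<subseteq> Basis \<longrightarrow>
        continuous_on U (pd_iter vs g) \<and>
        (\<forall>v\<in>Basis. \<forall>x\<in>U. (\<lambda>s. pd_iter vs g (x + s *\<^sub>R v)) differentiable (at 0)))"

definition Cb_inf :: "('e::euclidean_space \<Rightarrow> real) \<Rightarrow> bool" where
  "Cb_inf g \<longleftrightarrow> smooth_on UNIV g \<and> (\<forall>vs. set vs \<subseteq> Basis \<longrightarrow> bounded (range (pd_iter vs g)))"

definition laplacian :: "('e::euclidean_space \<Rightarrow> real) \<Rightarrow> 'e \<Rightarrow> real" where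
  "laplacian g x = (\<Sum>b\<in>Basis. dd (dd g b) b x)"

end

(* With H g s x = E g(x + X_s), conditioning on Y gives E_x g(Z_t) = int p_t(s) H g |s| x ds for the
   Gaussian density p_t. The density solves d/dt p = 1/2 d^2/ds^2 p, and d/ds H g = 1/2 H (Laplacian g),
   so two integrations by parts on the half line give the evolution equation; the inhomogeneous term
   is the boundary contribution at s = 0, where |s| has a kink. Smoothness in time then comes from
   iterating the equation: each time derivative is traded for spatial derivatives of g and powers of t. *)
theory Submission
  imports Defs "HOL-Real_Asymp.Real_Asymp"
begin

subsection \<open>Integration tools\<close>

text \<open>The function H has two descriptions, and the proof alternates between them. For s > 0 it
  is a Gaussian integral, which can be differentiated in s. As an expectation along a Brownian path
  it is continuous down to s = 0 and inherits every bound of g. The half-line argument needs exactly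
  this mixture: derivatives for s > 0, and a limit at the end point 0. The Gaussian formula does not
  mention the path, so both halves of X yield the same H, evaluated at |s|. The boundary
  contributions of the two half-lines add up, and this doubling cancels the factor 1/2 in the
  equation for p_t. Smoothness asks for every mixed derivative in every order. Instead of a formula
  for them, a class of space-time functions is exhibited that is closed under each single partial
  derivative. Negative powers of t enter this class, which confines it to t > 0.\<close>

lemma has_real_derivative_lebesgue_integral:
  fixes f f' :: "real \<Rightarrow> 'a \<Rightarrow> real"
  assumes S: "s0 \<in> {a<..<b}"
    and f_int: "\<And>s. s \<in> {a<..<b} \<Longrightarrow> integrable M (f s)"
    and f'_meas: "f' s0 \<in> borel_measurable M"
    and deriv: "\<And>s x. s \<in> {a<..<b} \<Longrightarrow> x \<in> space M \<Longrightarrow>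
                  ((\<lambda>s. f s x) has_real_derivative f' s x) (at s)"
    and bound: "\<And>s x. s \<in> {a<..<b} \<Longrightarrow> x \<in> space M \<Longrightarrow> \<bar>f' s x\<bar> \<le> w x"
    and w: "integrable M w"
  shows "((\<lambda>s. \<integral>x. f s x \<partial>M) has_real_derivative (\<integral>x. f' s0 x \<partial>M)) (at s0)"
proof -
  have "((\<lambda>s. ((\<integral>x. f s x \<partial>M) - (\<integral>x. f s0 x \<partial>M)) / (s - s0)) \<longlongrightarrow> (\<integral>x. f' s0 x \<partial>M))
          (at s0 within {a<..<b})"
    unfolding tendsto_at_iff_sequentially comp_def
  proof safe
    fix X :: "nat \<Rightarrow> real"
    assume X: "\<forall>i. X i \<in> {a<..<b} - {s0}" and lim: "X \<longlonglongrightarrow> s0"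
    have eq: "((\<integral>x. f (X i) x \<partial>M) - (\<integral>x. f s0 x \<partial>M)) / (X i - s0) =
               (\<integral>x. (f (X i) x - f s0 x) / (X i - s0) \<partial>M)" for i
      using f_int[of "X i"] f_int[OF S] X by simp
    show "(\<lambda>i. ((\<integral>x. f (X i) x \<partial>M) - (\<integral>x. f s0 x \<partial>M)) / (X i - s0)) \<longlonglongrightarrow> (\<integral>x. f' s0 x \<partial>M)"
      unfolding eq
    proof (rule integral_dominated_convergence[OF f'_meas _ w])
      show "(\<lambda>x. (f (X i) x - f s0 x) / (X i - s0)) \<in> borel_measurable M" for i
        using f_int[of "X i"] f_int[OF S] X by (auto intro!: borel_measurable_divide borel_measurable_diff)
      show "AE x in M. (\<lambda>i. (f (X i) x - f s0 x) / (X i - s0)) \<longlonglongrightarrow> f' s0 x"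
      proof (rule AE_I2)
        fix x assume "x \<in> space M"
        from deriv[OF S this] have "((\<lambda>y. (f y x - f s0 x) / (y - s0)) \<longlongrightarrow> f' s0 x) (at s0)"
          by (simp add: has_field_derivative_iff)
        then show "(\<lambda>i. (f (X i) x - f s0 x) / (X i - s0)) \<longlonglongrightarrow> f' s0 x"
          using X lim by (auto simp: tendsto_at_iff_sequentially comp_def)
      qed
      show "AE x in M. norm ((f (X i) x - f s0 x) / (X i - s0)) \<le> w x" for i
      proof (rule AE_I2)
        fix x assume x: "x \<in> space M"
        have Xi: "X i \<in> {a<..<b}" "X i \<noteq> s0" using X by auto
        \<comment> \<open>Mean value inequality: it needs the bound on \<open>f'\<close> along the
          whole segment from \<open>s0\<close> to \<open>X i\<close>, hence on the whole
          interval.\<close>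
        have "norm (f (X i) x - f s0 x) \<le> w x * norm (X i - s0)"
          by (rule field_differentiable_bound[where S = "{a<..<b}" and f' = "\<lambda>s. f' s x"])
             (use deriv bound x Xi S in \<open>auto intro: DERIV_subset\<close>)
        then show "norm ((f (X i) x - f s0 x) / (X i - s0)) \<le> w x"
          using Xi by (simp add: pos_divide_le_eq)
      qed
    qed
  qed
  then have "((\<lambda>s. ((\<integral>x. f s x \<partial>M) - (\<integral>x. f s0 x \<partial>M)) / (s - s0)) \<longlongrightarrow> (\<integral>x. f' s0 x \<partial>M)) (at s0)"
    using S by (subst (asm) at_within_open) auto
  then show ?thesis
    by (simp add: has_field_derivative_iff)
qed

text \<open>Averaging the derivative over a unit segment turns it into a difference of translates.\<close>
lemma lborel_integral_directional_derivative_eq_0: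
  fixes F F' :: "'b::euclidean_space \<Rightarrow> real"
  assumes F: "integrable lborel F" and F': "integrable lborel F'"
    and cont: "continuous_on UNIV F'"
    and deriv: "\<And>y. ((\<lambda>r. F (y + r *\<^sub>R e)) has_real_derivative F' y) (at 0)"
  shows "(\<integral>y. F' y \<partial>lborel) = 0"
proof -
  have meas [measurable]: "F' \<in> borel_measurable borel"
    using cont by (rule borel_measurable_continuous_onI)
  have transl: "has_bochner_integral lborel (\<lambda>y. G (c + y)) (\<integral>y. G y \<partial>lborel)"
    if "integrable lborel G" for G :: "'b \<Rightarrow> real" and c
  proof -
    have [measurable]: "G \<in> borel_measurable borel" using that by auto
    have "has_bochner_integral (distr lborel borel ((+) c)) G (\<integral>y. G y \<partial>lborel)"
      using that by (simp add: lborel_distr_plus has_bochner_integral_integrable)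
    then show ?thesis
      by (simp add: has_bochner_integral_iff integrable_distr_eq integral_distr)
  qed
  define I where "I = (\<integral>y. F' y \<partial>lborel)"
  define Iabs where "Iabs = (\<integral>y. \<bar>F' y\<bar> \<partial>lborel)"
  \<comment> \<open>By translation invariance the y-integral of |F'(r e + y)| does not depend on r,
    so cutting r down to a unit segment makes \<open>g\<close> integrable on the product and allows
    Fubini.\<close>
  define g where "g = (\<lambda>(r::real, y). indicator {0..1} r * F' (r *\<^sub>R e + y))"
  have g_meas [measurable]: "g \<in> borel_measurable (lborel \<Otimes>\<^sub>M lborel)"
    unfolding g_def by measurable
  have abs_int: "(\<integral>y. norm (g (r, y)) \<partial>lborel) = indicator {0..1} r * Iabs" for r
    using transl[of "\<lambda>y. \<bar>F' y\<bar>" "r *\<^sub>R e"] F'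
    by (auto simp: g_def abs_mult Iabs_def has_bochner_integral_iff)
  have int: "integrable (lborel \<Otimes>\<^sub>M lborel) g"
  proof (rule lborel_pair.Fubini_integrable)
    show "integrable lborel (\<lambda>r. \<integral>y. norm (g (r, y)) \<partial>lborel)"
      unfolding abs_int by (intro integrable_mult_left) (simp add: integrable_indicator_iff)
    show "AE r in lborel. integrable lborel (\<lambda>y. g (r, y))"
      using transl[OF F'] by (auto simp: g_def has_bochner_integral_iff)
  qed simp
  have inner: "(\<integral>r. g (r, y) \<partial>lborel) = F (e + y) - F y" for y
  proof -
    have "(\<integral>r. F' (r *\<^sub>R e + y) * indicator {0..1} r \<partial>lborel) = F (1 *\<^sub>R e + y) - F (0 *\<^sub>R e + y)"
    proof (rule integral_FTC_Icc_real)
      fix r :: real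
      have "((\<lambda>s. F ((r *\<^sub>R e + y) + s *\<^sub>R e)) has_real_derivative F' (r *\<^sub>R e + y)) (at (r - r))"
        using deriv[of "r *\<^sub>R e + y"] by simp
      then have "((\<lambda>s. F ((r *\<^sub>R e + y) + (s - r) *\<^sub>R e)) has_real_derivative F' (r *\<^sub>R e + y)) (at r)"
        using DERIV_shift[of "\<lambda>s. F ((r *\<^sub>R e + y) + s *\<^sub>R e)" "F' (r *\<^sub>R e + y)" r "- r"] by simp
      then show "((\<lambda>r. F (r *\<^sub>R e + y)) has_real_derivative F' (r *\<^sub>R e + y)) (at r)"
        by (simp add: algebra_simps)
      have "continuous_on UNIV (\<lambda>r. F' (r *\<^sub>R e + y))"
        by (rule continuous_on_compose2[OF cont]) (auto intro!: continuous_intros)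
      then show "isCont (\<lambda>r. F' (r *\<^sub>R e + y)) r"
        by (simp add: continuous_on_eq_continuous_at)
    qed simp
    then show ?thesis by (simp add: g_def mult.commute)
  qed
  \<comment> \<open>Integrating in r first gives F(e + y) - F(y), whose integral vanishes by
    translation invariance; integrating in y first gives the constant \<open>I\<close>.\<close>
  have "(\<integral>y. (\<integral>r. g (r, y) \<partial>lborel) \<partial>lborel) = (\<integral>r. (\<integral>y. g (r, y) \<partial>lborel) \<partial>lborel)"
    using lborel_pair.Fubini_integral[of "\<lambda>r y. g (r, y)"] int by simp
  also have "\<dots> = (\<integral>r. indicator {0..1} r * I \<partial>(lborel :: real measure))"
    using transl[OF F'] by (intro Bochner_Integration.integral_cong)
      (auto simp: g_def I_def has_bochner_integral_iff)
  also have "\<dots> = I" by simp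
  finally have "I = (\<integral>y. F (e + y) - F y \<partial>lborel)" by (simp add: inner)
  also have "\<dots> = 0"
    using transl[OF F, of e] F by (simp add: has_bochner_integral_iff)
  finally show ?thesis by (simp add: I_def)
qed

text \<open>The function factors over the coordinates, so its integral is a finite power of a
  one-dimensional Gaussian integral.\<close>

lemma integrable_exp_neg_norm_sq:
  assumes "0 < c"
  shows "integrable lborel (\<lambda>y::'b::euclidean_space. exp (- (c * (norm y)\<^sup>2)))"
proof (rule integrableI_bounded)
  have eq: "exp (- (c * (norm y)\<^sup>2)) = (\<Prod>b\<in>Basis. exp (- (c * (y \<bullet> b)\<^sup>2)))" for y :: 'b
    unfolding power2_norm_eq_inner
    by (subst euclidean_inner) (simp add: exp_sum[symmetric] sum_negf sum_distrib_left power2_eq_square)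
  have one: "integrable lborel (\<lambda>x::real. exp (- (c * x\<^sup>2)))"
  proof -
    \<comment> \<open>Variance 1/(2c) is the one whose normal density has exponent -c x^2.\<close>
    have eq: "exp (- (c * x\<^sup>2)) = sqrt (2 * pi * (1 / (2 * c))) * normal_density 0 (sqrt (1 / (2 * c))) x" for x
      using assms by (simp add: normal_density_def)
    show ?thesis
      unfolding eq
      using assms by (intro integrable_mult_right integrable_normal_density) auto
  qed
  have "(\<integral>\<^sup>+ y. ennreal (norm (exp (- (c * (norm y)\<^sup>2)))) \<partial>(lborel :: 'b measure)) =
        (\<integral>\<^sup>+ y. (\<Prod>b\<in>Basis. ennreal (exp (- (c * ((y::'b) \<bullet> b)\<^sup>2)))) \<partial>lborel)"
    by (simp add: prod_ennreal eq[symmetric])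
  also have "\<dots> = (\<Prod>b\<in>(Basis::'b set). (\<integral>\<^sup>+ x. ennreal (exp (- (c * x\<^sup>2))) \<partial>lborel))"
    by (rule nn_integral_lborel_prod) auto
  also have "\<dots> < \<infinity>"
    using one by (auto simp: power_less_top_ennreal integrable_iff_bounded)
  finally show "(\<integral>\<^sup>+ y. ennreal (norm (exp (- (c * (norm y)\<^sup>2)))) \<partial>(lborel :: 'b measure)) < \<infinity>" .
qed simp

text \<open>Half of the exponent absorbs the square: z <= exp z at z = (c/2)|y|^2.\<close>

lemma integrable_norm_sq_exp_neg_norm_sq:
  assumes "0 < c"
  shows "integrable lborel (\<lambda>y::'b::euclidean_space. (norm y)\<^sup>2 * exp (- (c * (norm y)\<^sup>2)))"
proof (rule Bochner_Integration.integrable_bound)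
  show "integrable lborel (\<lambda>y::'b. (2 / c) * exp (- ((c / 2) * (norm y)\<^sup>2)))"
    using assms by (intro integrable_mult_right integrable_exp_neg_norm_sq) auto
  show "AE y::'b in lborel. norm ((norm y)\<^sup>2 * exp (- (c * (norm y)\<^sup>2))) \<le>
          norm ((2 / c) * exp (- ((c / 2) * (norm y)\<^sup>2)))"
  proof (rule AE_I2)
    fix y :: 'b
    have "(c / 2) * (norm y)\<^sup>2 \<le> exp ((c / 2) * (norm y)\<^sup>2)"
      using exp_ge_add_one_self[of "(c / 2) * (norm y)\<^sup>2"] by linarith
    then have "(norm y)\<^sup>2 \<le> (2 / c) * exp ((c / 2) * (norm y)\<^sup>2)"
      using assms by (simp add: field_simps)
    then have "(norm y)\<^sup>2 * exp (- (c * (norm y)\<^sup>2)) \<le>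
          (2 / c) * exp ((c / 2) * (norm y)\<^sup>2) * exp (- (c * (norm y)\<^sup>2))"
      by (rule mult_right_mono) simp
    also have "\<dots> = (2 / c) * exp (- ((c / 2) * (norm y)\<^sup>2))"
      by (simp add: mult.assoc flip: exp_add)
    finally show "norm ((norm y)\<^sup>2 * exp (- (c * (norm y)\<^sup>2))) \<le>
          norm ((2 / c) * exp (- ((c / 2) * (norm y)\<^sup>2)))"
      using assms by simp
  qed
qed simp

subsection \<open>The Gaussian density\<close>

text \<open>Both the time derivative of \<open>gauss_dens\<close> and half its spatial Laplacian, as
  summing the second derivatives of \<open>has_real_derivative_gauss_dens_space2\<close> over the
  basis shows. This double role is the heat equation for the kernel.\<close>

definition gauss_dens_dt :: "real \<Rightarrow> 'b::euclidean_space \<Rightarrow> real" where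
  "gauss_dens_dt s y = ((norm y)\<^sup>2 / (2 * s\<^sup>2) - real DIM('b) / (2 * s)) * gauss_dens s y"

lemma gauss_dens_nonneg: "0 \<le> gauss_dens s y"
  by (simp add: gauss_dens_def)

lemma continuous_on_gauss_dens: "continuous_on A (gauss_dens s)"
  unfolding gauss_dens_def divide_inverse by (intro continuous_intros)

lemma borel_measurable_gauss_dens [measurable]: "gauss_dens s \<in> borel_measurable borel"
  by (intro borel_measurable_continuous_onI continuous_on_gauss_dens)

lemma borel_measurable_gauss_dens_dt [measurable]: "gauss_dens_dt s \<in> borel_measurable borel"
  unfolding gauss_dens_dt_def by measurable

lemma has_real_derivative_gauss_dens_time:
  fixes y :: "'b::euclidean_space"
  assumes s: "0 < s"
  shows "((\<lambda>s. gauss_dens s y) has_real_derivative gauss_dens_dt s y) (at s)"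
proof -
  let ?n = "- real DIM('b) / 2"
  have p: "((\<lambda>s. (2 * pi * s) powr a) has_real_derivative a / s * (2 * pi * s) powr a) (at s)" for a
    using s by (auto intro!: derivative_eq_intros simp: powr_diff field_simps)
  have e: "((\<lambda>s. exp (- ((norm y)\<^sup>2) / (2 * s))) has_real_derivative
             (norm y)\<^sup>2 / (2 * s\<^sup>2) * exp (- ((norm y)\<^sup>2) / (2 * s))) (at s)"
    using s by (auto intro!: derivative_eq_intros simp: power2_eq_square)
  show ?thesis
    unfolding gauss_dens_def
    by (rule DERIV_cong[OF DERIV_mult[OF p[of ?n] e]])
      (simp add: gauss_dens_dt_def gauss_dens_def ring_distribs mult_ac)
qed

lemma norm_add_scaleR_Basis_sq:
  assumes "b \<in> Basis"
  shows "(norm (y + r *\<^sub>R b))\<^sup>2 = (norm y)\<^sup>2 + 2 * r * (y \<bullet> b) + r\<^sup>2"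
  using assms unfolding power2_norm_eq_inner
  by (simp add: inner_add_left inner_add_right inner_commute algebra_simps power2_eq_square)

lemma has_real_derivative_gauss_dens_space:
  assumes "b \<in> Basis" "0 < s"
  shows "((\<lambda>r. gauss_dens s (y + r *\<^sub>R b)) has_real_derivative - ((y \<bullet> b) / s) * gauss_dens s y) (at 0)"
  unfolding gauss_dens_def norm_add_scaleR_Basis_sq[OF assms(1)]
  using assms(2) by (auto intro!: derivative_eq_intros simp: field_simps)

lemma has_real_derivative_gauss_dens_space2:
  assumes "b \<in> Basis" "0 < s"
  shows "((\<lambda>r. - (((y + r *\<^sub>R b) \<bullet> b) / s) * gauss_dens s (y + r *\<^sub>R b)) has_real_derivative
           ((y \<bullet> b)\<^sup>2 / s\<^sup>2 - 1 / s) * gauss_dens s y) (at 0)"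
proof -
  have l: "((\<lambda>r. - (((y + r *\<^sub>R b) \<bullet> b) / s)) has_real_derivative - 1 / s) (at 0)"
    using assms by (auto intro!: derivative_eq_intros simp: inner_add_left)
  show ?thesis
    by (rule DERIV_cong[OF DERIV_mult[OF l has_real_derivative_gauss_dens_space[OF assms]]])
      (use assms in \<open>simp add: field_simps power2_eq_square\<close>)
qed

text \<open>Quadratic growth is allowed because two spatial derivatives of the density bring down a
  polynomial factor of degree two.\<close>

lemma integrable_mult_gauss_dens:
  fixes H :: "'b::euclidean_space \<Rightarrow> real"
  assumes s: "0 < s" and [measurable]: "H \<in> borel_measurable borel"
    and H: "\<And>y. \<bar>H y\<bar> \<le> A + B * (norm y)\<^sup>2"
  shows "integrable lborel (\<lambda>y. H y * gauss_dens s y)"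
proof (rule Bochner_Integration.integrable_bound)
  let ?e = "\<lambda>y::'b. exp (- ((1 / (2 * s)) * (norm y)\<^sup>2))"
  let ?c = "(2 * pi * s) powr (- real DIM('b) / 2)"
  have g: "gauss_dens s y = ?c * ?e y" for y :: 'b
    by (simp add: gauss_dens_def)
  show "integrable lborel (\<lambda>y. ?c * (A * ?e y + B * ((norm y)\<^sup>2 * ?e y)))"
    using s by (intro integrable_mult_right Bochner_Integration.integrable_add
      integrable_exp_neg_norm_sq integrable_norm_sq_exp_neg_norm_sq) auto
  show "AE y in lborel. norm (H y * gauss_dens s y) \<le> norm (?c * (A * ?e y + B * ((norm y)\<^sup>2 * ?e y)))"
  proof (rule AE_I2)
    fix y :: 'b
    have "norm (H y * gauss_dens s y) \<le> (A + B * (norm y)\<^sup>2) * gauss_dens s y"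
      using H[of y] gauss_dens_nonneg[of s y] by (simp add: abs_mult mult_right_mono)
    also have "\<dots> = ?c * (A * ?e y + B * ((norm y)\<^sup>2 * ?e y))"
      by (simp add: g algebra_simps)
    finally show "norm (H y * gauss_dens s y) \<le> norm (?c * (A * ?e y + B * ((norm y)\<^sup>2 * ?e y)))"
      by simp
  qed
qed measurable

text \<open>Serves twice: in the state space with \<open>G\<close> a translate of g, to
  differentiate H in s; and on the line with \<open>G\<close> the function v -> H at |v|, to
  differentiate the solution in t.\<close>

lemma has_real_derivative_integral_gauss_dens:
  fixes G :: "'b::euclidean_space \<Rightarrow> real"
  assumes s: "0 < s" and [measurable]: "G \<in> borel_measurable borel" and G: "\<And>y. \<bar>G y\<bar> \<le> K"
  shows "((\<lambda>s. \<integral>y. G y * gauss_dens s y \<partial>lborel) has_real_derivative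
           (\<integral>y. G y * gauss_dens_dt s y \<partial>lborel)) (at s)"
proof -
  have K: "0 \<le> K" using G[of 0] by simp
  let ?n = "real DIM('b)"
  let ?c = "(pi * s) powr (- ?n / 2)"
  \<comment> \<open>Each factor takes its worst value for s/2 < t < 2s: t = s/2 in the power of t
    and in the polynomial, t = 2s in the exponential.\<close>
  let ?w = "\<lambda>y::'b. K * ((2 / s\<^sup>2 * (norm y)\<^sup>2 + ?n / s) * (?c * exp (- ((1 / (4 * s)) * (norm y)\<^sup>2))))"
  show ?thesis
  proof (rule has_real_derivative_lebesgue_integral[where a = "s / 2" and b = "2 * s" and w = ?w])
    show "integrable lborel (\<lambda>y. G y * gauss_dens t y)" if "t \<in> {s / 2<..<2 * s}" for t
      using that s G by (intro integrable_mult_gauss_dens[where A = K and B = 0]) auto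
    show "((\<lambda>s. G y * gauss_dens s y) has_real_derivative G y * gauss_dens_dt t y) (at t)"
      if "t \<in> {s / 2<..<2 * s}" for t and y
      using that s by (intro DERIV_cmult has_real_derivative_gauss_dens_time) auto
    show "\<bar>G y * gauss_dens_dt t y\<bar> \<le> ?w y" if t: "t \<in> {s / 2<..<2 * s}" for t and y
    proof -
      have t: "s / 2 < t" "t < 2 * s" using that by auto
      have t0: "0 < t" using t s by linarith
      have "s\<^sup>2 \<le> (2 * t)\<^sup>2" using t s by (intro power_mono) auto
      then have t2: "1 / (2 * t\<^sup>2) \<le> 2 / s\<^sup>2"
        using s t0 by (simp add: field_simps)
      have "(norm y)\<^sup>2 / (2 * t\<^sup>2) \<le> 2 / s\<^sup>2 * (norm y)\<^sup>2"
        using mult_right_mono[OF t2, of "(norm y)\<^sup>2"] by simp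
      moreover have "?n / (2 * t) \<le> ?n / s"
        using t s t0 by (intro divide_left_mono) auto
      moreover have "\<bar>(norm y)\<^sup>2 / (2 * t\<^sup>2)\<bar> = (norm y)\<^sup>2 / (2 * t\<^sup>2)" "\<bar>?n / (2 * t)\<bar> = ?n / (2 * t)"
        using t0 by simp_all
      ultimately have pol: "\<bar>(norm y)\<^sup>2 / (2 * t\<^sup>2) - ?n / (2 * t)\<bar> \<le> 2 / s\<^sup>2 * (norm y)\<^sup>2 + ?n / s"
        by (intro order_trans[OF abs_triangle_ineq4] add_mono) simp_all
      have "(2 * pi * t) powr (- ?n / 2) \<le> ?c"
      proof (rule powr_mono2')
        show "pi * s \<le> 2 * pi * t"
          using mult_left_mono[of s "2 * t" pi] t(1) by simp
      qed (use s in simp_all)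
      moreover have "exp (- ((norm y)\<^sup>2) / (2 * t)) \<le> exp (- ((1 / (4 * s)) * (norm y)\<^sup>2))"
      proof -
        have "(norm y)\<^sup>2 / (4 * s) \<le> (norm y)\<^sup>2 / (2 * t)"
          using t t0 s by (intro divide_left_mono) auto
        then show ?thesis by simp
      qed
      ultimately have "gauss_dens t y \<le> ?c * exp (- ((1 / (4 * s)) * (norm y)\<^sup>2))"
        unfolding gauss_dens_def by (intro mult_mono) auto
      then have "\<bar>gauss_dens_dt t y\<bar> \<le>
          (2 / s\<^sup>2 * (norm y)\<^sup>2 + ?n / s) * (?c * exp (- ((1 / (4 * s)) * (norm y)\<^sup>2)))"
        using pol gauss_dens_nonneg[of t y] s unfolding gauss_dens_dt_def abs_mult
        by (intro mult_mono) auto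
      then show ?thesis
        using G[of y] K unfolding abs_mult by (intro mult_mono) auto
    qed
    have w: "?w = (\<lambda>y::'b. K * (?c * ((2 / s\<^sup>2) * ((norm y)\<^sup>2 * exp (- ((1 / (4 * s)) * (norm y)\<^sup>2)))
                   + ?n / s * exp (- ((1 / (4 * s)) * (norm y)\<^sup>2)))))"
      by (rule ext) (simp only: ring_distribs mult_ac)
    show "integrable lborel ?w"
      unfolding w using s by (intro integrable_mult_right Bochner_Integration.integrable_add
        integrable_exp_neg_norm_sq integrable_norm_sq_exp_neg_norm_sq) auto
  qed (use s in auto)
qed

subsection \<open>Integration by parts against the Gaussian density\<close>

lemma pd_iter_append: "pd_iter (vs @ ws) g = pd_iter vs (pd_iter ws g)"
  by (induction vs) simp_all

text \<open>The last entry of the list is differentiated first, so iterated derivatives of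
  \<open>dd g b\<close> are those of \<open>g\<close> along lists ending in
  \<open>b\<close>.\<close>

lemma Cb_inf_dd:
  assumes "Cb_inf g" "b \<in> Basis"
  shows "Cb_inf (dd g b)"
proof -
  have "pd_iter vs (dd g b) = pd_iter (vs @ [b]) g" for vs
    by (simp add: pd_iter_append)
  moreover have "set (vs @ [b]) \<subseteq> Basis" if "set vs \<subseteq> Basis" for vs
    using that assms(2) by simp
  ultimately show ?thesis
    using assms(1) unfolding Cb_inf_def smooth_on_def by metis
qed

lemma Cb_inf_continuous_on: "Cb_inf g \<Longrightarrow> continuous_on A g"
  using continuous_on_subset[OF _ subset_UNIV]
  unfolding Cb_inf_def smooth_on_def by (metis pd_iter.simps(1) empty_subsetI list.set(1))

lemma Cb_inf_borel_measurable: "Cb_inf g \<Longrightarrow> g \<in> borel_measurable borel"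
  by (intro borel_measurable_continuous_onI Cb_inf_continuous_on)

lemma Cb_inf_bounded:
  assumes "Cb_inf g"
  obtains K where "\<And>x. \<bar>g x\<bar> \<le> K"
proof -
  have "bounded (range g)"
    using assms unfolding Cb_inf_def by (metis pd_iter.simps(1) empty_subsetI list.set(1))
  then show ?thesis
    using that by (auto simp: bounded_iff)
qed

lemma Cb_inf_has_real_derivative:
  assumes "Cb_inf g" "b \<in> Basis"
  shows "((\<lambda>s. g (x + s *\<^sub>R b)) has_real_derivative dd g b x) (at 0)"
proof -
  have "(\<lambda>s. g (x + s *\<^sub>R b)) differentiable (at 0)"
    using assms unfolding Cb_inf_def smooth_on_def
    by (metis pd_iter.simps(1) empty_subsetI list.set(1) UNIV_I)
  then show ?thesis
    by (simp add: dd_def DERIV_deriv_iff_real_differentiable)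
qed

text \<open>\<open>deriv\<close> is additive only where the derivatives exist; \<open>Cb_inf\<close>
  supplies this existence at every order, which carries the induction.\<close>

lemma pd_iter_sum:
  assumes "\<And>i. i \<in> I \<Longrightarrow> Cb_inf (g i)" "set vs \<subseteq> Basis"
  shows "pd_iter vs (\<lambda>x. \<Sum>i\<in>I. g i x) = (\<lambda>x. \<Sum>i\<in>I. pd_iter vs (g i) x)"
  using assms(2)
proof (induction vs)
  case (Cons v vs)
  have "((\<lambda>s. pd_iter vs (g i) (x + s *\<^sub>R v)) has_real_derivative pd_iter (v # vs) (g i) x) (at 0)"
    if "i \<in> I" for i x
    using assms(1)[OF that] Cons.prems unfolding Cb_inf_def smooth_on_def
    by (simp add: dd_def DERIV_deriv_iff_real_differentiable)
  then have "((\<lambda>s. \<Sum>i\<in>I. pd_iter vs (g i) (x + s *\<^sub>R v)) has_real_derivative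
      (\<Sum>i\<in>I. pd_iter (v # vs) (g i) x)) (at 0)" for x
    by (intro DERIV_sum) auto
  with Cons show ?case
    by (auto simp: dd_def[of "\<lambda>x. \<Sum>i\<in>I. pd_iter vs (g i) x"] intro!: ext DERIV_imp_deriv)
qed simp

lemma Cb_inf_sum:
  assumes "finite I" "\<And>i. i \<in> I \<Longrightarrow> Cb_inf (g i)"
  shows "Cb_inf (\<lambda>x. \<Sum>i\<in>I. g i x)"
proof -
  have "bounded (range (\<lambda>x. \<Sum>i\<in>I. pd_iter vs (g i) x))" if vs: "set vs \<subseteq> Basis" for vs
  proof -
    have "\<forall>i\<in>I. \<exists>K. \<forall>x. \<bar>pd_iter vs (g i) x\<bar> \<le> K"
      using assms(2) vs unfolding Cb_inf_def bounded_iff by auto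
    then obtain K where "\<And>i x. i \<in> I \<Longrightarrow> \<bar>pd_iter vs (g i) x\<bar> \<le> K i"
      by metis
    then have "\<bar>\<Sum>i\<in>I. pd_iter vs (g i) x\<bar> \<le> (\<Sum>i\<in>I. K i)" for x
      by (intro order_trans[OF sum_abs] sum_mono)
    then show ?thesis by (auto simp: bounded_iff)
  qed
  moreover have "continuous_on UNIV (\<lambda>x. \<Sum>i\<in>I. pd_iter vs (g i) x)" if "set vs \<subseteq> Basis" for vs
    using assms that unfolding Cb_inf_def smooth_on_def by (intro continuous_on_sum) auto
  moreover have "(\<lambda>s. \<Sum>i\<in>I. pd_iter vs (g i) (x + s *\<^sub>R v)) differentiable (at 0)"
    if "set vs \<subseteq> Basis" "v \<in> Basis" for vs v x
    using assms that unfolding Cb_inf_def smooth_on_def by (intro differentiable_sum) auto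
  ultimately show ?thesis
    unfolding Cb_inf_def smooth_on_def using assms(2) by (simp add: pd_iter_sum)
qed

lemma Cb_inf_laplacian:
  assumes "Cb_inf g"
  shows "Cb_inf (laplacian g)"
proof -
  have "Cb_inf (\<lambda>x. \<Sum>b\<in>Basis. dd (dd g b) b x)"
    by (intro Cb_inf_sum Cb_inf_dd assms) auto
  moreover have "laplacian g = (\<lambda>x. \<Sum>b\<in>Basis. dd (dd g b) b x)"
    by (rule ext) (simp add: laplacian_def)
  ultimately show ?thesis by simp
qed

section \<open>Moving derivatives from the Gaussian kernel to the function\<close>

lemma Cb_inf_integrable_mult_gauss_dens:
  assumes "Cb_inf g" "0 < s"
  shows "integrable lborel (\<lambda>y. g (x + y) * gauss_dens s y)"
proof -
  obtain K where "\<And>x. \<bar>g x\<bar> \<le> K" using Cb_inf_bounded[OF assms(1)] by blast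
  then show ?thesis
    using Cb_inf_borel_measurable[OF assms(1)] assms(2)
    by (intro integrable_mult_gauss_dens[where A = K and B = 0]) auto
qed

text \<open>Both integrations by parts are done at once, as in Green's second identity; Gaussian
  decay leaves no boundary term on the whole space.\<close>

lemma integral_mult_gauss_dens_second_derivative:
  fixes g :: "'b::euclidean_space \<Rightarrow> real"
  assumes g: "Cb_inf g" and s: "0 < s" and b: "b \<in> Basis"
  shows "integrable lborel (\<lambda>y. g (x + y) * (((y \<bullet> b)\<^sup>2 / s\<^sup>2 - 1 / s) * gauss_dens s y))" (is "?int")
    and "(\<integral>y. g (x + y) * (((y \<bullet> b)\<^sup>2 / s\<^sup>2 - 1 / s) * gauss_dens s y) \<partial>lborel) =
         (\<integral>y. dd (dd g b) b (x + y) * gauss_dens s y \<partial>lborel)" (is "?eq")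
proof -
  have g1: "Cb_inf (dd g b)" and g2: "Cb_inf (dd (dd g b) b)"
    using Cb_inf_dd g b by blast+
  obtain K where K: "\<And>x. \<bar>g x\<bar> \<le> K" using Cb_inf_bounded[OF g] by blast
  have K0: "0 \<le> K" using K[of 0] by linarith
  note [measurable] = Cb_inf_borel_measurable[OF g]
  have nb: "\<bar>y \<bullet> b\<bar> \<le> norm y" for y
    using Basis_le_norm[OF b] by simp
  have nb2: "(y \<bullet> b)\<^sup>2 \<le> (norm y)\<^sup>2" for y
    using power_mono[OF nb, of y 2] by simp
  \<comment> \<open>Puts the linear factor of the first derivative into the quadratic growth form of
    \<open>integrable_mult_gauss_dens\<close>.\<close>
  have nb1: "\<bar>y \<bullet> b\<bar> \<le> 1 + (norm y)\<^sup>2" for y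
  proof -
    have "norm y \<le> 1 + (norm y)\<^sup>2"
      using sum_squares_ge_zero[of "norm y - 1/2" 0] by (simp add: power2_eq_square algebra_simps)
    with nb[of y] show ?thesis by linarith
  qed
  have int1: "integrable lborel (\<lambda>y. (g (x + y) * - ((y \<bullet> b) / s)) * gauss_dens s y)"
  proof (rule integrable_mult_gauss_dens[OF s])
    fix y
    have "\<bar>g (x + y) * - ((y \<bullet> b) / s)\<bar> \<le> K * ((1 + (norm y)\<^sup>2) / s)"
      unfolding abs_mult using K K0 nb1 s by (intro mult_mono) (auto simp: divide_right_mono)
    then show "\<bar>g (x + y) * - ((y \<bullet> b) / s)\<bar> \<le> K / s + K / s * (norm y)\<^sup>2"
      by (simp add: ring_distribs add_divide_distrib)
  qed measurable
  have "integrable lborel (\<lambda>y. (g (x + y) * ((y \<bullet> b)\<^sup>2 / s\<^sup>2 - 1 / s)) * gauss_dens s y)"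
  proof (rule integrable_mult_gauss_dens[OF s])
    fix y
    have "(y \<bullet> b)\<^sup>2 / s\<^sup>2 \<le> (norm y)\<^sup>2 / s\<^sup>2" "0 \<le> (y \<bullet> b)\<^sup>2 / s\<^sup>2" "0 \<le> 1 / s"
      using nb2 s by (simp_all add: divide_right_mono)
    then have "\<bar>(y \<bullet> b)\<^sup>2 / s\<^sup>2 - 1 / s\<bar> \<le> 1 / s + (norm y)\<^sup>2 / s\<^sup>2"
      by linarith
    then have "\<bar>g (x + y) * ((y \<bullet> b)\<^sup>2 / s\<^sup>2 - 1 / s)\<bar> \<le> K * (1 / s + (norm y)\<^sup>2 / s\<^sup>2)"
      unfolding abs_mult using K K0 by (intro mult_mono) auto
    then show "\<bar>g (x + y) * ((y \<bullet> b)\<^sup>2 / s\<^sup>2 - 1 / s)\<bar> \<le> K / s + K / s\<^sup>2 * (norm y)\<^sup>2"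
      by (simp add: ring_distribs)
  qed measurable
  then show ?int by (simp only: mult.assoc)
  let ?q' = "\<lambda>y. - ((y \<bullet> b) / s) * gauss_dens s y"
  let ?q'' = "\<lambda>y. ((y \<bullet> b)\<^sup>2 / s\<^sup>2 - 1 / s) * gauss_dens s y"
  \<comment> \<open>In the derivative of this combination the two products of first derivatives
    cancel, leaving \<open>?F'\<close>.\<close>
  let ?F = "\<lambda>y. g (x + y) * ?q' y - dd g b (x + y) * gauss_dens s y"
  let ?F' = "\<lambda>y. g (x + y) * ?q'' y - dd (dd g b) b (x + y) * gauss_dens s y"
  have "(\<integral>y. ?F' y \<partial>lborel) = 0"
  proof (rule lborel_integral_directional_derivative_eq_0[where F = ?F and e = b])
    show "integrable lborel ?F"
      using int1 Cb_inf_integrable_mult_gauss_dens[OF g1 s]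
      by (intro Bochner_Integration.integrable_diff) (simp_all only: mult.assoc)
    show "integrable lborel ?F'"
      using \<open>?int\<close> Cb_inf_integrable_mult_gauss_dens[OF g2 s]
      by (intro Bochner_Integration.integrable_diff)
    have "continuous_on UNIV (\<lambda>y. g (x + y))" "continuous_on UNIV (\<lambda>y. dd (dd g b) b (x + y))"
      by (rule continuous_on_compose2[OF Cb_inf_continuous_on[of _ UNIV]];
          use g g2 in \<open>auto intro!: continuous_intros\<close>)+
    then show "continuous_on UNIV ?F'"
      unfolding divide_inverse by (intro continuous_intros continuous_on_gauss_dens)
  next
    fix y
    have d0: "((\<lambda>r. g (x + (y + r *\<^sub>R b))) has_real_derivative dd g b (x + y)) (at 0)"
      using Cb_inf_has_real_derivative[OF g b, of "x + y"] by (simp add: add.assoc)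
    have d1: "((\<lambda>r. dd g b (x + (y + r *\<^sub>R b))) has_real_derivative dd (dd g b) b (x + y)) (at 0)"
      using Cb_inf_has_real_derivative[OF g1 b, of "x + y"] by (simp add: add.assoc)
    show "((\<lambda>r. ?F (y + r *\<^sub>R b)) has_real_derivative ?F' y) (at 0)"
      by (rule DERIV_cong[OF DERIV_diff[OF
            DERIV_mult[OF d0 has_real_derivative_gauss_dens_space2[OF b s]]
            DERIV_mult[OF d1 has_real_derivative_gauss_dens_space[OF b s]]]])
        simp
  qed
  then show ?eq
    using \<open>?int\<close> Cb_inf_integrable_mult_gauss_dens[OF g2 s, of x] by simp
qed

text \<open>\<open>gauss_dens_dt\<close> is half the sum over the basis of the second derivatives of
  the kernel, and each of these moves to \<open>g\<close> by the previous lemma.\<close>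

lemma integral_mult_gauss_dens_dt:
  fixes g :: "'b::euclidean_space \<Rightarrow> real"
  assumes g: "Cb_inf g" and s: "0 < s"
  shows "(\<integral>y. g (x + y) * gauss_dens_dt s y \<partial>lborel) =
         1 / 2 * (\<integral>y. laplacian g (x + y) * gauss_dens s y \<partial>lborel)"
proof -
  have sq: "(norm y)\<^sup>2 = (\<Sum>b\<in>Basis. (y \<bullet> b)\<^sup>2)" for y :: 'b
    unfolding power2_norm_eq_inner by (subst euclidean_inner) (simp add: power2_eq_square)
  have dt: "g (x + y) * gauss_dens_dt s y =
      1 / 2 * (\<Sum>b\<in>Basis. g (x + y) * (((y \<bullet> b)\<^sup>2 / s\<^sup>2 - 1 / s) * gauss_dens s y))" for y
  proof -
    have "(\<Sum>b\<in>(Basis::'b set). (y \<bullet> b)\<^sup>2 / s\<^sup>2 - 1 / s) = (norm y)\<^sup>2 / s\<^sup>2 - real DIM('b) / s"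
      by (simp add: sum_subtractf sq sum_divide_distrib)
    then have "(\<Sum>b\<in>Basis. g (x + y) * (((y \<bullet> b)\<^sup>2 / s\<^sup>2 - 1 / s) * gauss_dens s y)) =
        g (x + y) * (((norm y)\<^sup>2 / s\<^sup>2 - real DIM('b) / s) * gauss_dens s y)"
      by (simp only: sum_distrib_left[symmetric] sum_distrib_right[symmetric])
    then show ?thesis
      by (simp add: gauss_dens_dt_def algebra_simps)
  qed
  have "(\<integral>y. g (x + y) * gauss_dens_dt s y \<partial>lborel) =
      1 / 2 * (\<Sum>b\<in>Basis. \<integral>y. dd (dd g b) b (x + y) * gauss_dens s y \<partial>lborel)"
    unfolding dt using integral_mult_gauss_dens_second_derivative[OF g s]
    by (simp add: Bochner_Integration.integral_sum)
  also have "(\<Sum>b\<in>Basis. \<integral>y. dd (dd g b) b (x + y) * gauss_dens s y \<partial>lborel) =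
      (\<integral>y. laplacian g (x + y) * gauss_dens s y \<partial>lborel)"
    unfolding laplacian_def sum_distrib_right
    by (rule Bochner_Integration.integral_sum[symmetric])
      (intro Cb_inf_integrable_mult_gauss_dens Cb_inf_dd g s)
  finally show ?thesis .
qed

text \<open>To be applied with \<open>h\<close> = H and \<open>k\<close>, \<open>l\<close> its first
  two s-derivatives. The even extension of \<open>h\<close> has slope jump 2 k(0) at 0. Green's
  identity on the half-line leaves k(0) p(0), evenness doubles it, and the factor 1/2 in
  \<open>gauss_dens_dt\<close> = p''/2 undoes the doubling.\<close>

lemma integral_abs_mult_gauss_dens_dt:
  fixes h k l :: "real \<Rightarrow> real"
  assumes t: "0 < t"
    and cont: "continuous_on {0..} h" "continuous_on {0..} k" "continuous_on {0..} l"
    and bound: "\<And>s. 0 \<le> s \<Longrightarrow> \<bar>h s\<bar> \<le> K" "\<And>s. 0 \<le> s \<Longrightarrow> \<bar>k s\<bar> \<le> K" "\<And>s. 0 \<le> s \<Longrightarrow> \<bar>l s\<bar> \<le> K"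
    and h: "\<And>s. 0 < s \<Longrightarrow> (h has_real_derivative k s) (at s)"
    and k: "\<And>s. 0 < s \<Longrightarrow> (k has_real_derivative l s) (at s)"
  shows "(\<integral>s. h \<bar>s\<bar> * gauss_dens_dt t s \<partial>lborel) =
         1 / 2 * (\<integral>s. l \<bar>s\<bar> * gauss_dens t s \<partial>lborel) + k 0 * gauss_dens t (0::real)"
proof -
  let ?p = "gauss_dens t :: real \<Rightarrow> real"
  have K: "0 \<le> K" using bound(1)[of 0] by simp
  define p' p'' where "p' = (\<lambda>s. - (s / t) * ?p s)" and "p'' = (\<lambda>s. (s\<^sup>2 / t\<^sup>2 - 1 / t) * ?p s)"
  have dp: "(?p has_real_derivative p' s) (at s)" for s
    using has_real_derivative_gauss_dens_space[of "1::real" t s] t DERIV_shift[of ?p "p' s" 0 s]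
    by (simp add: p'_def add.commute)
  have dp': "(p' has_real_derivative p'' s) (at s)" for s
    using has_real_derivative_gauss_dens_space2[of "1::real" t s] t DERIV_shift[of p' "p'' s" 0 s]
    by (simp add: p'_def p''_def add.commute)
  have dt: "gauss_dens_dt t s = 1 / 2 * p'' s" for s :: real
    by (simp add: gauss_dens_dt_def p''_def algebra_simps)
  have contp: "continuous_on A ?p" "continuous_on A p'" "continuous_on A p''" for A
    unfolding p'_def p''_def divide_inverse
    by (auto intro!: continuous_intros continuous_on_gauss_dens)
  have cabs: "continuous_on UNIV (\<lambda>s. c \<bar>s\<bar>)" if "continuous_on {0..} c" for c :: "real \<Rightarrow> real"
    by (rule continuous_on_compose2[OF that]) (auto intro!: continuous_intros)
  have [measurable]: "(\<lambda>s. h \<bar>s\<bar>) \<in> borel_measurable borel" "(\<lambda>s. l \<bar>s\<bar>) \<in> borel_measurable borel"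
    by (intro borel_measurable_continuous_onI cabs cont)+
  have int_l: "integrable lborel (\<lambda>s. l \<bar>s\<bar> * ?p s)"
    using bound t by (intro integrable_mult_gauss_dens[where A = K and B = 0]) auto
  have "integrable lborel (\<lambda>s. (h \<bar>s\<bar> * (s\<^sup>2 / t\<^sup>2 - 1 / t)) * ?p s)"
  proof (rule integrable_mult_gauss_dens[OF t])
    fix s :: real
    have "0 \<le> s\<^sup>2 / t\<^sup>2" "0 \<le> 1 / t" using t by auto
    then have "\<bar>s\<^sup>2 / t\<^sup>2 - 1 / t\<bar> \<le> 1 / t + s\<^sup>2 / t\<^sup>2" by linarith
    then have "\<bar>h \<bar>s\<bar> * (s\<^sup>2 / t\<^sup>2 - 1 / t)\<bar> \<le> K * (1 / t + s\<^sup>2 / t\<^sup>2)"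
      unfolding abs_mult using bound(1) K by (intro mult_mono) auto
    then show "\<bar>h \<bar>s\<bar> * (s\<^sup>2 / t\<^sup>2 - 1 / t)\<bar> \<le> K / t + K / t\<^sup>2 * (norm s)\<^sup>2"
      by (simp add: ring_distribs)
  qed measurable
  then have int_h: "integrable lborel (\<lambda>s. h \<bar>s\<bar> * p'' s)"
    by (simp add: p''_def mult.assoc)
  define f where "f = (\<lambda>s. h \<bar>s\<bar> * p'' s - l \<bar>s\<bar> * ?p s)"
  \<comment> \<open>Antiderivative of \<open>f\<close> for s > 0, the terms k p' cancelling. Since
    p'(0) = 0, only the second product survives at s = 0.\<close>
  define F where "F = (\<lambda>s. h s * p' s - k s * ?p s)"
  have int_f: "integrable lborel f"
    unfolding f_def using int_h int_l by simp
  have contF: "continuous_on {0..} F"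
    unfolding F_def by (intro continuous_intros cont contp)
  have "(LBINT s=0..\<infinity>. f s) = 0 - F 0"
  proof (rule interval_integral_FTC_integrable)
    fix s assume "0 < ereal s"
    then have s: "0 < s" by simp
    show "(F has_vector_derivative f s) (at s)"
      unfolding has_real_derivative_iff_has_vector_derivative[symmetric] F_def
      by (rule DERIV_cong[OF DERIV_diff[OF DERIV_mult[OF h[OF s] dp'] DERIV_mult[OF k[OF s] dp]]])
        (use s in \<open>simp add: f_def algebra_simps\<close>)
    have "continuous_on UNIV f"
      unfolding f_def by (intro continuous_intros contp cabs cont)
    then show "isCont f s" by (simp add: continuous_on_eq_continuous_at)
  next
    show "set_integrable lborel (einterval 0 \<infinity>) f"
      using int_f unfolding set_integrable_def
      by (intro integrable_mult_indicator) auto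
    \<comment> \<open>The derivatives of \<open>h\<close> and \<open>k\<close> are given only for s
      > 0; one-sided continuity at 0 supplies the lower boundary value.\<close>
    have "(F \<longlongrightarrow> F 0) (at 0 within {0..})"
      using contF by (auto simp: continuous_on_def)
    then show "((F \<circ> real_of_ereal) \<longlongrightarrow> F 0) (at_right 0)"
      unfolding zero_ereal_def ereal_tendsto_simps
      by (rule tendsto_within_subset) auto
    let ?c = "(2 * pi * t) powr (- 1 / 2)"
    have "(F \<longlongrightarrow> 0) at_top"
    proof (rule Lim_null_comparison)
      show "((\<lambda>s. K * (s / t * (?c * exp (- s\<^sup>2 / (2 * t)))) + K * (?c * exp (- s\<^sup>2 / (2 * t)))) \<longlongrightarrow> 0) at_top"
        using t by real_asymp
      show "\<forall>\<^sub>F s in at_top. norm (F s) \<le>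
          K * (s / t * (?c * exp (- s\<^sup>2 / (2 * t)))) + K * (?c * exp (- s\<^sup>2 / (2 * t)))"
        using eventually_ge_at_top[of 0]
      proof eventually_elim
        case (elim s)
        have "norm (F s) \<le> \<bar>h s * p' s\<bar> + \<bar>k s * ?p s\<bar>"
          unfolding F_def real_norm_def by (rule abs_triangle_ineq4)
        also have "\<dots> \<le> K * (s / t * ?p s) + K * ?p s"
          unfolding abs_mult using bound elim K t gauss_dens_nonneg[of t s]
          by (intro add_mono mult_mono) (auto simp: p'_def abs_mult)
        finally show ?case
          by (simp add: gauss_dens_def)
      qed
    qed
    then show "((F \<circ> real_of_ereal) \<longlongrightarrow> 0) (at_left \<infinity>)"
      by (simp add: ereal_tendsto_simps)
  qed simp
  also have "F 0 = - k 0 * ?p 0"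
    by (simp add: F_def p'_def)
  \<comment> \<open>The fundamental theorem works on the open half-line, the evenness rule below on
    the closed one; they differ by a null set.\<close>
  also have "(LBINT s=0..\<infinity>. f s) = (\<integral>s. indicator {0..} s *\<^sub>R f s \<partial>lborel)"
  proof -
    have "(LBINT s=0..\<infinity>. f s) = (\<integral>s. indicator {0<..} s *\<^sub>R f s \<partial>lborel)"
      by (simp add: interval_lebesgue_integral_def set_lebesgue_integral_def einterval_def
          greaterThan_def zero_ereal_def)
    also have "\<dots> = (\<integral>s. indicator {0..} s *\<^sub>R f s \<partial>lborel)"
      using AE_lborel_singleton[of "0::real"] int_f
      by (intro integral_cong_AE) (auto simp: indicator_def)
    finally show ?thesis .
  qed
  finally have half: "(\<integral>s. indicator {0..} s *\<^sub>R f s \<partial>lborel) = k 0 * ?p 0"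
    by simp
  have "has_bochner_integral lborel f (2 *\<^sub>R (k 0 * ?p 0))"
  proof (rule has_bochner_integral_even_function)
    show "has_bochner_integral lborel (\<lambda>s. indicator {0..} s *\<^sub>R f s) (k 0 * ?p 0)"
      unfolding half[symmetric] using int_f
      by (intro has_bochner_integral_integrable integrable_mult_indicator) auto
  qed (simp add: f_def p''_def gauss_dens_def)
  then have "(\<integral>s. f s \<partial>lborel) = 2 * (k 0 * ?p 0)"
    by (simp add: has_bochner_integral_iff)
  then have "(\<integral>s. h \<bar>s\<bar> * p'' s \<partial>lborel) = (\<integral>s. l \<bar>s\<bar> * ?p s \<partial>lborel) + 2 * (k 0 * ?p 0)"
    unfolding f_def using int_h int_l by simp
  then show ?thesis
    by (simp add: dt algebra_simps)
qed

subsection \<open>Brownian motion at an independent random time\<close>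

text \<open>Turns path continuity into continuity of expectations: in s for the heat semigroup, and
  jointly in (t, x) for the solution.\<close>

lemma (in finite_measure) continuous_on_integral_bounded:
  fixes \<phi> :: "'c::metric_space \<Rightarrow> 'a \<Rightarrow> real"
  assumes meas: "\<And>z. z \<in> S \<Longrightarrow> \<phi> z \<in> borel_measurable M"
    and cont: "\<And>\<omega>. \<omega> \<in> space M \<Longrightarrow> continuous_on S (\<lambda>z. \<phi> z \<omega>)"
    and bound: "\<And>z \<omega>. z \<in> S \<Longrightarrow> \<omega> \<in> space M \<Longrightarrow> \<bar>\<phi> z \<omega>\<bar> \<le> K"
  shows "continuous_on S (\<lambda>z. \<integral>\<omega>. \<phi> z \<omega> \<partial>M)"
  unfolding continuous_on_sequentially comp_def
proof safe
  fix x a assume x: "a \<in> S" "\<forall>n. x n \<in> S" "x \<longlonglongrightarrow> a"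
  show "(\<lambda>n. \<integral>\<omega>. \<phi> (x n) \<omega> \<partial>M) \<longlonglongrightarrow> (\<integral>\<omega>. \<phi> a \<omega> \<partial>M)"
  proof (rule integral_dominated_convergence[where w = "\<lambda>_. K"])
    show "AE \<omega> in M. (\<lambda>n. \<phi> (x n) \<omega>) \<longlonglongrightarrow> \<phi> a \<omega>"
      using cont x by (auto simp: continuous_on_sequentially comp_def)
  qed (use meas bound x in auto)
qed

lemma is_BM_measurable: "is_BM M B \<Longrightarrow> 0 \<le> t \<Longrightarrow> B t \<in> borel_measurable M"
  by (simp add: is_BM_def)

lemma is_BM_start: "is_BM M B \<Longrightarrow> \<omega> \<in> space M \<Longrightarrow> B 0 \<omega> = 0"
  by (simp add: is_BM_def)

lemma is_BM_continuous_on: "is_BM M B \<Longrightarrow> \<omega> \<in> space M \<Longrightarrow> continuous_on {0..} (\<lambda>t. B t \<omega>)"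
  by (simp add: is_BM_def)

lemma is_BM_integral:
  fixes B :: "real \<Rightarrow> 'a \<Rightarrow> 'b::euclidean_space" and G :: "'b \<Rightarrow> real"
  assumes "is_BM M B" "0 < s" and [measurable]: "G \<in> borel_measurable borel"
  shows "(\<integral>\<omega>. G (B s \<omega>) \<partial>M) = (\<integral>y. G y * gauss_dens s y \<partial>lborel)"
proof -
  have "distributed M lborel (\<lambda>\<omega>. B s \<omega> - B 0 \<omega>) (\<lambda>y. ennreal (gauss_dens s y))"
    using assms(1,2) unfolding is_BM_def by (elim conjE allE[of _ "0::real"] allE[of _ s]) simp
  from distributed_integral[OF this, of G]
  have "(\<integral>y. gauss_dens s y * G y \<partial>lborel) = (\<integral>\<omega>. G (B s \<omega> - B 0 \<omega>) \<partial>M)"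
    by (simp add: gauss_dens_nonneg)
  also have "\<dots> = (\<integral>\<omega>. G (B s \<omega>) \<partial>M)"
    using is_BM_start[OF assms(1)] by (intro Bochner_Integration.integral_cong) auto
  finally show ?thesis by (simp add: mult.commute)
qed

section \<open>The heat semigroup and its two descriptions\<close>

text \<open>The function H of the overview. The time 0 needs its own branch: there the formula of
  \<open>gauss_dens\<close> evaluates to the zero function instead of a point mass.\<close>

definition heat :: "('b::euclidean_space \<Rightarrow> real) \<Rightarrow> real \<Rightarrow> 'b \<Rightarrow> real" where
  "heat g s x = (if 0 < s then \<integral>y. g (x + y) * gauss_dens s y \<partial>lborel else g x)"

text \<open>The right-hand side does not depend on \<open>B\<close>: this identifies the
  contributions of \<open>Xp\<close> and \<open>Xm\<close> later on.\<close>

lemma is_BM_expectation_heat: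
  fixes B :: "real \<Rightarrow> 'a \<Rightarrow> 'b::euclidean_space" and g :: "'b \<Rightarrow> real"
  assumes B: "is_BM M B" and g: "Cb_inf g" and s: "0 \<le> s"
  shows "(\<integral>\<omega>. g (x + B s \<omega>) \<partial>M) = heat g s x"
proof (cases "s = 0")
  case True
  interpret prob_space M using B by (simp add: is_BM_def)
  have "(\<integral>\<omega>. g (x + B s \<omega>) \<partial>M) = (\<integral>\<omega>. g x \<partial>M)"
    using True is_BM_start[OF B] by (intro Bochner_Integration.integral_cong) auto
  with True show ?thesis by (simp add: heat_def prob_space)
next
  case False
  then show ?thesis
    using is_BM_integral[OF B, of s "\<lambda>y. g (x + y)"] s Cb_inf_borel_measurable[OF g]
    by (simp add: heat_def)
qed

text \<open>Path continuity gives this including s = 0, where the Gaussian integral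
  degenerates.\<close>

lemma is_BM_continuous_on_heat:
  fixes B :: "real \<Rightarrow> 'a \<Rightarrow> 'b::euclidean_space" and g :: "'b \<Rightarrow> real"
  assumes B: "is_BM M B" and g: "Cb_inf g"
  shows "continuous_on {0..} (\<lambda>s. heat g s x)"
proof -
  interpret prob_space M using B by (simp add: is_BM_def)
  obtain K where K: "\<And>x. \<bar>g x\<bar> \<le> K" using Cb_inf_bounded[OF g] by blast
  have "continuous_on {0..} (\<lambda>s. \<integral>\<omega>. g (x + B s \<omega>) \<partial>M)"
  proof (rule continuous_on_integral_bounded)
    show "(\<lambda>\<omega>. g (x + B s \<omega>)) \<in> borel_measurable M" if "s \<in> {0..}" for s
      using is_BM_measurable[OF B, of s] Cb_inf_borel_measurable[OF g] that by simp
    show "continuous_on {0..} (\<lambda>s. g (x + B s \<omega>))" if "\<omega> \<in> space M" for \<omega>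
      by (rule continuous_on_compose2[OF Cb_inf_continuous_on[OF g, of UNIV]])
        (auto intro!: continuous_intros is_BM_continuous_on[OF B that])
  qed (rule K)
  then show ?thesis
    by (rule continuous_on_eq) (simp add: is_BM_expectation_heat[OF B g])
qed

lemma is_BM_heat_bounded:
  fixes B :: "real \<Rightarrow> 'a \<Rightarrow> 'b::euclidean_space" and g :: "'b \<Rightarrow> real"
  assumes B: "is_BM M B" and g: "Cb_inf g" and K: "\<And>x. \<bar>g x\<bar> \<le> K" and s: "0 \<le> s"
  shows "\<bar>heat g s x\<bar> \<le> K"
proof -
  interpret prob_space M using B by (simp add: is_BM_def)
  have [measurable]: "(\<lambda>\<omega>. g (x + B s \<omega>)) \<in> borel_measurable M"
    using is_BM_measurable[OF B s] Cb_inf_borel_measurable[OF g] by simp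
  have "\<bar>\<integral>\<omega>. g (x + B s \<omega>) \<partial>M\<bar> \<le> (\<integral>\<omega>. \<bar>g (x + B s \<omega>)\<bar> \<partial>M)"
    by (rule integral_abs_bound)
  also have "\<dots> \<le> K"
    using K by (intro integral_le_const integrable_const_bound[where B = K]) auto
  finally show ?thesis
    using is_BM_expectation_heat[OF B g s, of x] by simp
qed

text \<open>Differentiate the kernel in s under the integral, then pass its Laplacian on to
  \<open>g\<close>.\<close>

lemma has_real_derivative_heat:
  assumes g: "Cb_inf g" and s: "0 < s"
  shows "((\<lambda>s. heat g s x) has_real_derivative 1 / 2 * heat (laplacian g) s x) (at s)"
proof -
  obtain K where K: "\<And>x. \<bar>g x\<bar> \<le> K" using Cb_inf_bounded[OF g] by blast
  have "((\<lambda>s. \<integral>y. g (x + y) * gauss_dens s y \<partial>lborel) has_real_derivative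
          1 / 2 * heat (laplacian g) s x) (at s)"
    using has_real_derivative_integral_gauss_dens[OF s, of "\<lambda>y. g (x + y)" K] K s
      Cb_inf_borel_measurable[OF g] integral_mult_gauss_dens_dt[OF g s, of x]
    by (simp add: heat_def)
  then show ?thesis
    by (rule has_field_derivative_transform_within_open[where S = "{0<..}"])
      (use s in \<open>auto simp: heat_def\<close>)
qed

section \<open>Sampling a path at a random time through grids\<close>

text \<open>Truncated at $(m+1)^2$ so that a random time is rounded to finitely many grid points.\<close>
definition grid_index :: "nat \<Rightarrow> real \<Rightarrow> nat" where
  "grid_index m v = min (nat \<lfloor>real (Suc m) * \<bar>v\<bar>\<rfloor>) (Suc m ^ 2)"

definition grid_point :: "nat \<Rightarrow> nat \<Rightarrow> real" where
  "grid_point m k = real k / real (Suc m)"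

lemma grid_point_nonneg: "0 \<le> grid_point m k"
  by (simp add: grid_point_def)

lemma grid_index_le: "grid_index m v \<le> Suc m ^ 2"
  by (simp add: grid_index_def)

lemma measurable_grid_index [measurable]: "grid_index m \<in> borel \<rightarrow>\<^sub>M count_space UNIV"
  unfolding grid_index_def by measurable

lemma grid_point_tendsto: "(\<lambda>m. grid_point m (grid_index m v)) \<longlonglongrightarrow> \<bar>v\<bar>"
proof (rule tendsto_sandwich)
  \<comment> \<open>From here on the truncation is inactive and the rounding error is at most
    1/(m+1).\<close>
  have ev: "\<forall>\<^sub>F m in sequentially. \<bar>v\<bar> \<le> real (Suc m)"
    using eventually_ge_at_top[of "nat \<lceil>\<bar>v\<bar>\<rceil>"] by eventually_elim linarith
  have eq: "grid_point m (grid_index m v) = of_int \<lfloor>real (Suc m) * \<bar>v\<bar>\<rfloor> / real (Suc m)"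
    if "\<bar>v\<bar> \<le> real (Suc m)" for m
  proof -
    have "real (Suc m) * \<bar>v\<bar> \<le> real (Suc m) * real (Suc m)"
      using that by (intro mult_left_mono) auto
    then have "\<lfloor>real (Suc m) * \<bar>v\<bar>\<rfloor> \<le> int (Suc m ^ 2)"
      by (simp add: floor_le_iff power2_eq_square algebra_simps)
    then have "nat \<lfloor>real (Suc m) * \<bar>v\<bar>\<rfloor> \<le> Suc m ^ 2"
      by (simp only: nat_le_iff)
    then show ?thesis
      by (simp add: grid_point_def grid_index_def)
  qed
  show "\<forall>\<^sub>F m in sequentially. \<bar>v\<bar> - 1 / real (Suc m) \<le> grid_point m (grid_index m v)"
    using ev
  proof eventually_elim
    case (elim m)
    have "real (Suc m) * \<bar>v\<bar> - 1 \<le> of_int \<lfloor>real (Suc m) * \<bar>v\<bar>\<rfloor>"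
      by linarith
    then have "(real (Suc m) * \<bar>v\<bar> - 1) / real (Suc m) \<le> of_int \<lfloor>real (Suc m) * \<bar>v\<bar>\<rfloor> / real (Suc m)"
      by (rule divide_right_mono) simp
    then show ?case
      unfolding eq[OF elim] by (simp add: diff_divide_distrib)
  qed
  show "\<forall>\<^sub>F m in sequentially. grid_point m (grid_index m v) \<le> \<bar>v\<bar>"
    using ev
  proof eventually_elim
    case (elim m)
    have "of_int \<lfloor>real (Suc m) * \<bar>v\<bar>\<rfloor> / real (Suc m) \<le> (real (Suc m) * \<bar>v\<bar>) / real (Suc m)"
      by (rule divide_right_mono) auto
    then show ?case unfolding eq[OF elim] by simp
  qed
  have "(\<lambda>m. \<bar>v\<bar> - 1 / real (Suc m)) \<longlonglongrightarrow> \<bar>v\<bar> - 0"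
    by (intro tendsto_diff tendsto_const LIMSEQ_Suc[OF lim_1_over_n])
  then show "(\<lambda>m. \<bar>v\<bar> - 1 / real (Suc m)) \<longlonglongrightarrow> \<bar>v\<bar>" by simp
qed simp

lemma is_BM_grid_tendsto:
  assumes "is_BM M B" "\<omega> \<in> space M"
  shows "(\<lambda>m. B (grid_point m (grid_index m v)) \<omega>) \<longlonglongrightarrow> B \<bar>v\<bar> \<omega>"
  by (rule continuous_on_tendsto_compose[OF is_BM_continuous_on[OF assms] grid_point_tendsto])
    (simp_all add: grid_point_nonneg)

text \<open>\<open>is_BM\<close> speaks of measurability at fixed times only. At a rounded time just
  countably many fixed times occur, and path continuity passes measurability to the limit.\<close>

lemma is_BM_measurable_random_time:
  fixes B :: "real \<Rightarrow> 'a \<Rightarrow> 'b::euclidean_space"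
  assumes B: "is_BM M B" and [measurable]: "V \<in> borel_measurable M"
  shows "(\<lambda>\<omega>. B \<bar>V \<omega>\<bar> \<omega>) \<in> borel_measurable M"
proof (rule borel_measurable_LIMSEQ_metric)
  show "(\<lambda>\<omega>. B (grid_point m (grid_index m (V \<omega>))) \<omega>) \<in> borel_measurable M" for m
    by (rule measurable_compose_countable[where f = "\<lambda>k. B (grid_point m k)"])
      (auto intro: is_BM_measurable[OF B grid_point_nonneg])
qed (rule is_BM_grid_tendsto[OF B])

text \<open>Independence is given for the sigma-algebras of whole processes; this restricts it to
  functions of single values, as \<open>indep_var\<close> requires.\<close>

lemma sigma_sets_vimage_proc_sigma:
  fixes \<phi> :: "'b::topological_space \<Rightarrow> 'c::topological_space"
  assumes s: "0 \<le> s" and \<phi>: "\<phi> \<in> borel_measurable borel"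
  shows "sigma_sets (space M) {(\<lambda>\<omega>. \<phi> (B s \<omega>)) -` A \<inter> space M | A. A \<in> sets borel} \<subseteq> proc_sigma M B"
  unfolding proc_sigma_def
proof (rule sigma_sets_mono', safe)
  fix A :: "'c set" assume "A \<in> sets borel"
  then have "\<phi> -` A \<in> sets borel" using measurable_sets_borel[OF \<phi>] by simp
  moreover have "(\<lambda>\<omega>. \<phi> (B s \<omega>)) -` A \<inter> space M = B s -` (\<phi> -` A) \<inter> space M" by auto
  ultimately show "\<exists>t A'. (\<lambda>\<omega>. \<phi> (B s \<omega>)) -` A \<inter> space M = B t -` A' \<inter> space M \<and> 0 \<le> t \<and> A' \<in> sets borel"
    using s by blast
qed

lemma (in prob_space) indep_var_proc_sigma:
  fixes \<phi> \<psi> :: "_ \<Rightarrow> real"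
  assumes "indep_set (proc_sigma M B) (proc_sigma M Y)"
    and "0 \<le> s" "0 \<le> t" and "B s \<in> borel_measurable M" "Y t \<in> borel_measurable M"
    and "\<phi> \<in> borel_measurable borel" "\<psi> \<in> borel_measurable borel"
  shows "indep_var borel (\<lambda>\<omega>. \<phi> (B s \<omega>)) borel (\<lambda>\<omega>. \<psi> (Y t \<omega>))"
  unfolding indep_var_eq
proof (intro conjI)
  show "indep_set (sigma_sets (space M) {(\<lambda>\<omega>. \<phi> (B s \<omega>)) -` A \<inter> space M | A. A \<in> sets borel})
     (sigma_sets (space M) {(\<lambda>\<omega>. \<psi> (Y t \<omega>)) -` A \<inter> space M | A. A \<in> sets borel})"
    using assms(1) sigma_sets_vimage_proc_sigma[OF assms(2,6), of M B]
      sigma_sets_vimage_proc_sigma[OF assms(3,7), of M Y]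
    unfolding indep_sets2_eq by blast
qed (use assms in measurable)

text \<open>Conditioning on the value of an independent time: on each grid the time takes finitely many
  values, and path continuity lets the mesh go to zero.\<close>
lemma (in prob_space) expectation_independent_time:
  fixes B :: "real \<Rightarrow> 'a \<Rightarrow> 'b::euclidean_space" and g :: "'b \<Rightarrow> real"
  assumes B: "is_BM M B" and g: "Cb_inf g"
    and indep: "indep_set (proc_sigma M B) (proc_sigma M Y)"
    and t: "0 \<le> t" and V [measurable]: "Y t \<in> borel_measurable M"
    and A [measurable]: "A \<in> sets borel"
  shows "expectation (\<lambda>\<omega>. indicator A (Y t \<omega>) * g (x + B \<bar>Y t \<omega>\<bar> \<omega>)) =
         expectation (\<lambda>\<omega>. indicator A (Y t \<omega>) * heat g \<bar>Y t \<omega>\<bar> x)"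
proof -
  note [measurable] = Cb_inf_borel_measurable[OF g]
  have Bk [measurable]: "B (grid_point m k) \<in> borel_measurable M" for m k
    by (rule is_BM_measurable[OF B grid_point_nonneg])
  obtain K where K: "\<And>x. \<bar>g x\<bar> \<le> K" using Cb_inf_bounded[OF g] by blast
  have K0: "0 \<le> K" using K[of 0] by linarith
  let ?\<tau> = "\<lambda>m \<omega>. grid_point m (grid_index m (Y t \<omega>))"
  have meas_h [measurable]: "(\<lambda>v. heat g \<bar>v\<bar> x) \<in> borel_measurable borel"
    by (intro borel_measurable_continuous_onI
        continuous_on_compose2[OF is_BM_continuous_on_heat[OF B g]]) (auto intro!: continuous_intros)
  have meas_hk [measurable]: "(\<lambda>v. heat g (grid_point m (grid_index m v)) x) \<in> borel_measurable borel" for m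
    by (rule measurable_compose[OF measurable_grid_index]) simp
  have meas_gk [measurable]: "(\<lambda>\<omega>. g (x + B (?\<tau> m \<omega>) \<omega>)) \<in> borel_measurable M" for m
    by (rule measurable_compose_countable[where f = "\<lambda>k \<omega>. g (x + B (grid_point m k) \<omega>)"]) auto
  have "expectation (\<lambda>\<omega>. indicator A (Y t \<omega>) * g (x + B (?\<tau> m \<omega>) \<omega>)) =
        expectation (\<lambda>\<omega>. indicator A (Y t \<omega>) * heat g (?\<tau> m \<omega>) x)" for m
  proof -
    \<comment> \<open>These cells partition \<open>A\<close>; on the k-th one the rounded time is
      the constant \<open>grid_point m k\<close>.\<close>
    let ?I = "\<lambda>k v. indicator (A \<inter> grid_index m -` {k}) v :: real"
    have meas_I [measurable]: "A \<inter> grid_index m -` {k} \<in> sets borel" for k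
      using measurable_sets[OF measurable_grid_index, of "{k}" m] by auto
    have split: "indicator A v * F (grid_index m v) = (\<Sum>k\<le>Suc m ^ 2. F k * ?I k v)"
      for F :: "nat \<Rightarrow> real" and v
    proof -
      have "(\<Sum>k\<le>Suc m ^ 2. F k * ?I k v) =
          (\<Sum>k\<le>Suc m ^ 2. if k = grid_index m v then F k * indicator A v else 0)"
        by (intro sum.cong) (auto simp: indicator_def)
      also have "\<dots> = F (grid_index m v) * indicator A v"
        by (subst sum.delta) (use grid_index_le in auto)
      finally show ?thesis by (simp add: mult.commute)
    qed
    \<comment> \<open>With the time frozen, one factor depends on \<open>B\<close> and the other on
      \<open>Y\<close>, so the expectation factorizes.\<close>
    have ind: "expectation (\<lambda>\<omega>. g (x + B (grid_point m k) \<omega>) * ?I k (Y t \<omega>)) =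
        heat g (grid_point m k) x * expectation (\<lambda>\<omega>. ?I k (Y t \<omega>))"
      and int: "integrable M (\<lambda>\<omega>. g (x + B (grid_point m k) \<omega>) * ?I k (Y t \<omega>))" for k
    proof -
      have iv: "indep_var borel (\<lambda>\<omega>. g (x + B (grid_point m k) \<omega>)) borel (\<lambda>\<omega>. ?I k (Y t \<omega>))"
        by (rule indep_var_proc_sigma[OF indep grid_point_nonneg t Bk V]) measurable
      have i1: "integrable M (\<lambda>\<omega>. g (x + B (grid_point m k) \<omega>))"
        using K by (intro integrable_const_bound[where B = K]) auto
      have i2: "integrable M (\<lambda>\<omega>. ?I k (Y t \<omega>))"
        by (intro integrable_const_bound[where B = 1]) auto
      show "expectation (\<lambda>\<omega>. g (x + B (grid_point m k) \<omega>) * ?I k (Y t \<omega>)) =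
          heat g (grid_point m k) x * expectation (\<lambda>\<omega>. ?I k (Y t \<omega>))"
        using indep_var_lebesgue_integral[OF iv i1 i2]
          is_BM_expectation_heat[OF B g grid_point_nonneg] by simp
      show "integrable M (\<lambda>\<omega>. g (x + B (grid_point m k) \<omega>) * ?I k (Y t \<omega>))"
        by (rule indep_var_integrable[OF iv i1 i2])
    qed
    have int2: "integrable M (\<lambda>\<omega>. c * ?I k (Y t \<omega>))" for c k
      by (intro integrable_mult_right integrable_const_bound[where B = 1]) auto
    have "expectation (\<lambda>\<omega>. indicator A (Y t \<omega>) * g (x + B (?\<tau> m \<omega>) \<omega>)) =
        expectation (\<lambda>\<omega>. \<Sum>k\<le>Suc m ^ 2. g (x + B (grid_point m k) \<omega>) * ?I k (Y t \<omega>))"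
      by (subst split[of _ "\<lambda>k. g (x + B (grid_point m k) _)"]) (rule refl)
    also have "\<dots> = (\<Sum>k\<le>Suc m ^ 2. heat g (grid_point m k) x * expectation (\<lambda>\<omega>. ?I k (Y t \<omega>)))"
      by (subst Bochner_Integration.integral_sum) (use int ind in auto)
    also have "\<dots> = expectation (\<lambda>\<omega>. \<Sum>k\<le>Suc m ^ 2. heat g (grid_point m k) x * ?I k (Y t \<omega>))"
      by (subst Bochner_Integration.integral_sum) (use int2 in auto)
    also have "\<dots> = expectation (\<lambda>\<omega>. indicator A (Y t \<omega>) * heat g (?\<tau> m \<omega>) x)"
      by (subst split[of _ "\<lambda>k. heat g (grid_point m k) x"]) (rule refl)
    finally show ?thesis .
  qed
  moreover have "(\<lambda>m. expectation (\<lambda>\<omega>. indicator A (Y t \<omega>) * g (x + B (?\<tau> m \<omega>) \<omega>))) \<longlonglongrightarrow>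
      expectation (\<lambda>\<omega>. indicator A (Y t \<omega>) * g (x + B \<bar>Y t \<omega>\<bar> \<omega>))"
  proof (rule integral_dominated_convergence[where w = "\<lambda>_. K"])
    show "(\<lambda>\<omega>. indicator A (Y t \<omega>) * g (x + B \<bar>Y t \<omega>\<bar> \<omega>)) \<in> borel_measurable M"
      using is_BM_measurable_random_time[OF B V] by measurable
    show "AE \<omega> in M. (\<lambda>m. indicator A (Y t \<omega>) * g (x + B (?\<tau> m \<omega>) \<omega>)) \<longlonglongrightarrow>
        indicator A (Y t \<omega>) * g (x + B \<bar>Y t \<omega>\<bar> \<omega>)"
      using Cb_inf_continuous_on[OF g, of UNIV]
      by (intro AE_I2 tendsto_mult tendsto_const isCont_tendsto_compose[of _ g] tendsto_add
          is_BM_grid_tendsto[OF B]) (auto simp: continuous_on_eq_continuous_at)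
    show "AE \<omega> in M. norm (indicator A (Y t \<omega>) * g (x + B (?\<tau> m \<omega>) \<omega>)) \<le> K" for m
      using K K0 by (intro AE_I2) (auto simp: indicator_def)
  qed auto
  moreover have "(\<lambda>m. expectation (\<lambda>\<omega>. indicator A (Y t \<omega>) * heat g (?\<tau> m \<omega>) x)) \<longlonglongrightarrow>
      expectation (\<lambda>\<omega>. indicator A (Y t \<omega>) * heat g \<bar>Y t \<omega>\<bar> x)"
  proof (rule integral_dominated_convergence[where w = "\<lambda>_. K"])
    have "(\<lambda>m. heat g (grid_point m (grid_index m v)) x) \<longlonglongrightarrow> heat g \<bar>v\<bar> x" for v
      by (rule continuous_on_tendsto_compose[OF is_BM_continuous_on_heat[OF B g] grid_point_tendsto])
        (simp_all add: grid_point_nonneg)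
    then show "AE \<omega> in M. (\<lambda>m. indicator A (Y t \<omega>) * heat g (?\<tau> m \<omega>) x) \<longlonglongrightarrow>
        indicator A (Y t \<omega>) * heat g \<bar>Y t \<omega>\<bar> x"
      by (intro AE_I2 tendsto_mult tendsto_const)
    show "AE \<omega> in M. norm (indicator A (Y t \<omega>) * heat g (?\<tau> m \<omega>) x) \<le> K" for m
      using is_BM_heat_bounded[OF B g K grid_point_nonneg] K0
      by (intro AE_I2) (auto simp: indicator_def)
  qed auto
  ultimately show ?thesis
    using LIMSEQ_unique by simp
qed

subsection \<open>The evolution equation\<close>

text \<open>Conditioning is done separately on the events Y t >= 0 and Y t < 0, and on each of them
  one of \<open>Xp\<close>, \<open>Xm\<close> is run at a time given by \<open>Y\<close>; the two
  pairwise independences match this split.\<close>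

locale iterated_BM = prob_space M for M :: "'a measure" +
  fixes Xp Xm :: "real \<Rightarrow> 'a \<Rightarrow> 'b::euclidean_space" and Y :: "real \<Rightarrow> 'a \<Rightarrow> real"
  assumes Xp: "is_BM M Xp" and Xm: "is_BM M Xm" and Y: "is_BM M Y"
    and indep_Xp_Y: "indep_set (proc_sigma M Xp) (proc_sigma M Y)"
    and indep_Xm_Y: "indep_set (proc_sigma M Xm) (proc_sigma M Y)"
begin

definition Z :: "real \<Rightarrow> 'a \<Rightarrow> 'b" where
  "Z t \<omega> = two_sided Xp Xm (Y t \<omega>) \<omega>"

text \<open>An operator on \<open>g\<close>: the starting point enters only by translation, so
  spatial derivatives of \<open>U g t\<close> become \<open>U\<close> of derivatives of
  \<open>g\<close>.\<close>

definition U :: "('b \<Rightarrow> real) \<Rightarrow> real \<Rightarrow> 'b \<Rightarrow> real" where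
  "U g t x = expectation (\<lambda>\<omega>. g (x + Z t \<omega>))"

lemma Z_altdef: "Z t \<omega> = (if 0 \<le> Y t \<omega> then Xp \<bar>Y t \<omega>\<bar> \<omega> else Xm \<bar>Y t \<omega>\<bar> \<omega>)"
  by (simp add: Z_def two_sided_def)

lemma Z_measurable:
  assumes "0 \<le> t"
  shows "Z t \<in> borel_measurable M"
proof -
  have V [measurable]: "Y t \<in> borel_measurable M" by (rule is_BM_measurable[OF Y assms])
  note [measurable] = is_BM_measurable_random_time[OF Xp V] is_BM_measurable_random_time[OF Xm V]
  show ?thesis
    unfolding Z_altdef[abs_def] by (intro measurable_If) measurable
qed

lemma integrand_measurable:
  assumes "Cb_inf g" "0 \<le> t"
  shows "(\<lambda>\<omega>. g (x + Z t \<omega>)) \<in> borel_measurable M"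
  by (rule measurable_compose[OF _ Cb_inf_borel_measurable[OF assms(1)]])
    (intro borel_measurable_add borel_measurable_const Z_measurable assms(2))

lemma integrand_integrable:
  assumes "Cb_inf g" "0 \<le> t"
  shows "integrable M (\<lambda>\<omega>. g (x + Z t \<omega>))"
proof -
  obtain K where "\<And>x. \<bar>g x\<bar> \<le> K" using Cb_inf_bounded[OF assms(1)] by blast
  then show ?thesis
    using integrand_measurable[OF assms] by (intro integrable_const_bound[where B = K]) auto
qed

text \<open>The two halves can be pasted at time 0 because both paths vanish there.\<close>

lemma two_sided_continuous:
  assumes "\<omega> \<in> space M"
  shows "continuous_on UNIV (\<lambda>s. two_sided Xp Xm s \<omega>)"
proof -
  have "continuous_on ({0..} \<union> {..0}) (\<lambda>s. if 0 \<le> s then Xp s \<omega> else Xm (- s) \<omega>)"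
  proof (rule continuous_on_cases)
    show "continuous_on {..0} (\<lambda>s. Xm (- s) \<omega>)"
      by (rule continuous_on_compose2[OF is_BM_continuous_on[OF Xm assms]])
        (auto intro!: continuous_intros)
    show "\<forall>s. s \<in> {0..} \<and> \<not> 0 \<le> s \<or> s \<in> {..0} \<and> 0 \<le> s \<longrightarrow> Xp s \<omega> = Xm (- s) \<omega>"
      using is_BM_start[OF Xp assms] is_BM_start[OF Xm assms] by auto
  qed (auto intro: is_BM_continuous_on[OF Xp assms])
  moreover have "{0..} \<union> {..0} = (UNIV :: real set)" by auto
  ultimately show ?thesis by (simp add: two_sided_def)
qed

text \<open>Argued with paths rather than densities, so that t = 0 is included.\<close>

lemma continuous_on_U:
  assumes g: "Cb_inf g"
  shows "continuous_on ({0..} \<times> UNIV) (\<lambda>p. U g (fst p) (snd p))"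
proof -
  obtain K where K: "\<And>x. \<bar>g x\<bar> \<le> K" using Cb_inf_bounded[OF g] by blast
  show ?thesis
    unfolding U_def
  proof (rule continuous_on_integral_bounded)
    fix \<omega> assume \<omega>: "\<omega> \<in> space M"
    have "continuous_on ({0..} \<times> UNIV) (\<lambda>p::real \<times> 'b. Y (fst p) \<omega>)"
      by (rule continuous_on_compose2[OF is_BM_continuous_on[OF Y \<omega>]])
        (auto intro!: continuous_intros)
    then have "continuous_on ({0..} \<times> UNIV) (\<lambda>p::real \<times> 'b. Z (fst p) \<omega>)"
      unfolding Z_def by (rule continuous_on_compose2[OF two_sided_continuous[OF \<omega>]]) auto
    then show "continuous_on ({0..} \<times> UNIV) (\<lambda>p. g (snd p + Z (fst p) \<omega>))"
      by (intro continuous_on_compose2[OF Cb_inf_continuous_on[OF g, of UNIV]] continuous_intros) auto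
  qed (use integrand_measurable[OF g] K in auto)
qed

lemma U_bounded:
  assumes g: "Cb_inf g" and K: "\<And>x. \<bar>g x\<bar> \<le> K" and t: "0 \<le> t"
  shows "\<bar>U g t x\<bar> \<le> K"
proof -
  have "\<bar>U g t x\<bar> \<le> expectation (\<lambda>\<omega>. \<bar>g (x + Z t \<omega>)\<bar>)"
    unfolding U_def by (rule integral_abs_bound)
  also have "\<dots> \<le> K"
    using K integrand_integrable[OF g t] by (intro integral_le_const) auto
  finally show ?thesis .
qed

lemma U_0: "U g 0 x = g x"
proof -
  have "U g 0 x = expectation (\<lambda>_. g x)"
    unfolding U_def Z_altdef
    using is_BM_start[OF Xp] is_BM_start[OF Y] by (intro Bochner_Integration.integral_cong) auto
  then show ?thesis by (simp add: prob_space)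
qed

lemma U_sum:
  assumes "\<And>i. i \<in> I \<Longrightarrow> Cb_inf (g i)" "0 \<le> t"
  shows "U (\<lambda>y. \<Sum>i\<in>I. g i y) t x = (\<Sum>i\<in>I. U (g i) t x)"
  unfolding U_def by (intro Bochner_Integration.integral_sum integrand_integrable assms)

lemma has_real_derivative_U_space:
  assumes g: "Cb_inf g" and b: "b \<in> Basis" and t: "0 \<le> t"
  shows "((\<lambda>s. U g t (x + s *\<^sub>R b)) has_real_derivative U (dd g b) t x) (at 0)"
proof -
  have g1: "Cb_inf (dd g b)" by (rule Cb_inf_dd[OF g b])
  obtain K where K: "\<And>x. \<bar>dd g b x\<bar> \<le> K" using Cb_inf_bounded[OF g1] by blast
  have "((\<lambda>s. U g t (x + s *\<^sub>R b)) has_real_derivative U (dd g b) t (x + 0 *\<^sub>R b)) (at 0)"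
    unfolding U_def
  proof (rule has_real_derivative_lebesgue_integral[where a = "-1" and b = 1 and w = "\<lambda>_. K"])
    fix s \<omega>
    show "((\<lambda>s. g (x + s *\<^sub>R b + Z t \<omega>)) has_real_derivative dd g b (x + s *\<^sub>R b + Z t \<omega>)) (at s)"
      using Cb_inf_has_real_derivative[OF g b, of "x + s *\<^sub>R b + Z t \<omega>"]
        DERIV_shift[of "\<lambda>s. g (x + s *\<^sub>R b + Z t \<omega>)" _ 0 s]
      by (simp add: algebra_simps)
  qed (use integrand_integrable[OF g t] integrand_measurable[OF g1 t] K in auto)
  then show ?thesis by simp
qed

lemma dd_U: "Cb_inf g \<Longrightarrow> b \<in> Basis \<Longrightarrow> 0 \<le> t \<Longrightarrow> dd (U g t) b = U (dd g b) t"
  using DERIV_imp_deriv[OF has_real_derivative_U_space] by (intro ext) (simp add: dd_def[of "U g t"])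

lemma laplacian_U:
  assumes g: "Cb_inf g" and t: "0 \<le> t"
  shows "laplacian (U g t) = U (laplacian g) t"
proof (rule ext)
  fix x
  have "laplacian g = (\<lambda>x. \<Sum>b\<in>Basis. dd (dd g b) b x)"
    by (rule ext) (simp add: laplacian_def)
  then show "laplacian (U g t) x = U (laplacian g) t x"
    using U_sum[of Basis "\<lambda>b. dd (dd g b) b" t x] g t
    by (simp add: laplacian_def[of "U g t"] dd_U Cb_inf_dd)
qed

text \<open>Splitting by the sign of \<open>Y t\<close> makes the time nonnegative for whichever of
  \<open>Xp\<close>, \<open>Xm\<close> is in use. Conditioning replaces either process by the same
  function \<open>heat g\<close>, and the two pieces recombine.\<close>

lemma U_eq_expectation_heat:
  assumes g: "Cb_inf g" and t: "0 \<le> t"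
  shows "U g t x = expectation (\<lambda>\<omega>. heat g \<bar>Y t \<omega>\<bar> x)"
proof -
  have V [measurable]: "Y t \<in> borel_measurable M" by (rule is_BM_measurable[OF Y t])
  obtain K where K: "\<And>x. \<bar>g x\<bar> \<le> K" using Cb_inf_bounded[OF g] by blast
  have K0: "0 \<le> K" using K[of 0] by linarith
  note [measurable] = Cb_inf_borel_measurable[OF g]
    is_BM_measurable_random_time[OF Xp V] is_BM_measurable_random_time[OF Xm V]
  have [measurable]: "(\<lambda>v. heat g \<bar>v\<bar> x) \<in> borel_measurable borel"
    by (intro borel_measurable_continuous_onI
        continuous_on_compose2[OF is_BM_continuous_on_heat[OF Xp g]]) (auto intro!: continuous_intros)
  have hK: "\<bar>heat g \<bar>v\<bar> x\<bar> \<le> K" for v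
    by (rule is_BM_heat_bounded[OF Xp g K]) simp
  have int: "integrable M (\<lambda>\<omega>. indicator A (Y t \<omega>) * F \<omega>)"
    if "A \<in> sets borel" "F \<in> borel_measurable M" "\<And>\<omega>. \<bar>F \<omega>\<bar> \<le> K" for A :: "real set" and F
    using that K0 by (intro integrable_const_bound[where B = K]) (auto simp: indicator_def)
  have "U g t x = expectation (\<lambda>\<omega>. indicator {0..} (Y t \<omega>) * g (x + Xp \<bar>Y t \<omega>\<bar> \<omega>) +
      indicator {..<0} (Y t \<omega>) * g (x + Xm \<bar>Y t \<omega>\<bar> \<omega>))"
    unfolding U_def Z_altdef by (intro Bochner_Integration.integral_cong) (auto simp: indicator_def)
  also have "\<dots> = expectation (\<lambda>\<omega>. indicator {0..} (Y t \<omega>) * g (x + Xp \<bar>Y t \<omega>\<bar> \<omega>)) +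
      expectation (\<lambda>\<omega>. indicator {..<0} (Y t \<omega>) * g (x + Xm \<bar>Y t \<omega>\<bar> \<omega>))"
    using K by (intro Bochner_Integration.integral_add int) auto
  also have "\<dots> = expectation (\<lambda>\<omega>. indicator {0..} (Y t \<omega>) * heat g \<bar>Y t \<omega>\<bar> x) +
      expectation (\<lambda>\<omega>. indicator {..<0} (Y t \<omega>) * heat g \<bar>Y t \<omega>\<bar> x)"
    using expectation_independent_time[OF Xp g indep_Xp_Y t V, of "{0..}" x]
      expectation_independent_time[OF Xm g indep_Xm_Y t V, of "{..<0}" x] by simp
  also have "\<dots> = expectation (\<lambda>\<omega>. indicator {0..} (Y t \<omega>) * heat g \<bar>Y t \<omega>\<bar> x +
      indicator {..<0} (Y t \<omega>) * heat g \<bar>Y t \<omega>\<bar> x)"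
    using hK by (intro Bochner_Integration.integral_add[symmetric] int) auto
  also have "\<dots> = expectation (\<lambda>\<omega>. heat g \<bar>Y t \<omega>\<bar> x)"
    by (intro Bochner_Integration.integral_cong) (auto simp: indicator_def)
  finally show ?thesis .
qed

lemma U_eq_integral:
  assumes g: "Cb_inf g" and t: "0 < t"
  shows "U g t x = (\<integral>s. heat g \<bar>s\<bar> x * gauss_dens t s \<partial>lborel)"
proof -
  have "(\<lambda>v. heat g \<bar>v\<bar> x) \<in> borel_measurable borel"
    by (intro borel_measurable_continuous_onI
        continuous_on_compose2[OF is_BM_continuous_on_heat[OF Xp g]]) (auto intro!: continuous_intros)
  from is_BM_integral[OF Y t this] show ?thesis
    using U_eq_expectation_heat[OF g, of t x] t by simp
qed

text \<open>Two s-derivatives of \<open>heat g\<close> give 1/4 times \<open>heat\<close> of the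
  iterated Laplacian; the equation for p_t contributes another 1/2, whence 1/8. The last term is the
  slope at 0, half of \<open>laplacian g x\<close>, times p_t(0).\<close>

lemma has_real_derivative_U_time:
  assumes g: "Cb_inf g" and t: "0 < t"
  shows "((\<lambda>t. U g t x) has_real_derivative
           1 / 8 * U (laplacian (laplacian g)) t x + 1 / 2 * (1 / sqrt (2 * pi * t)) * laplacian g x) (at t)"
proof -
  let ?g1 = "laplacian g" and ?g2 = "laplacian (laplacian g)"
  have g1: "Cb_inf ?g1" and g2: "Cb_inf ?g2"
    by (intro Cb_inf_laplacian g)+
  obtain K0 K1 K2 where K0: "\<And>x. \<bar>g x\<bar> \<le> K0" and K1: "\<And>x. \<bar>?g1 x\<bar> \<le> K1" and K2: "\<And>x. \<bar>?g2 x\<bar> \<le> K2"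
    using Cb_inf_bounded[OF g] Cb_inf_bounded[OF g1] Cb_inf_bounded[OF g2] by metis
  \<comment> \<open>A common bound for \<open>heat g\<close> and its first two
    s-derivatives.\<close>
  let ?K = "K0 + K1 + K2"
  have nn: "0 \<le> K0" "0 \<le> K1" "0 \<le> K2"
    using K0[of 0] K1[of 0] K2[of 0] by linarith+
  have b0: "\<bar>heat g s x\<bar> \<le> K0" and b1: "\<bar>heat ?g1 s x\<bar> \<le> K1" and b2: "\<bar>heat ?g2 s x\<bar> \<le> K2" if "0 \<le> s" for s
    using is_BM_heat_bounded[OF Xp g K0 that] is_BM_heat_bounded[OF Xp g1 K1 that]
      is_BM_heat_bounded[OF Xp g2 K2 that] by blast+
  have "(\<lambda>v. heat g \<bar>v\<bar> x) \<in> borel_measurable borel"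
    by (intro borel_measurable_continuous_onI
        continuous_on_compose2[OF is_BM_continuous_on_heat[OF Xp g]]) (auto intro!: continuous_intros)
  then have "((\<lambda>t. \<integral>s. heat g \<bar>s\<bar> x * gauss_dens t s \<partial>lborel) has_real_derivative
      (\<integral>s. heat g \<bar>s\<bar> x * gauss_dens_dt t s \<partial>lborel)) (at t)"
    using t b0 by (intro has_real_derivative_integral_gauss_dens[where K = K0]) auto
  then have der: "((\<lambda>t. U g t x) has_real_derivative (\<integral>s. heat g \<bar>s\<bar> x * gauss_dens_dt t s \<partial>lborel)) (at t)"
    by (rule has_field_derivative_transform_within_open[where S = "{0<..}"])
      (use t U_eq_integral[OF g] in auto)
  have "(\<integral>s. heat g \<bar>s\<bar> x * gauss_dens_dt t s \<partial>lborel) =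
      1 / 2 * (\<integral>s. (1 / 4 * heat ?g2 \<bar>s\<bar> x) * gauss_dens t s \<partial>lborel) +
      (1 / 2 * heat ?g1 0 x) * gauss_dens t (0::real)"
  proof (rule integral_abs_mult_gauss_dens_dt[OF t, where K = ?K])
    show "continuous_on {0..} (\<lambda>s. heat g s x)"
      by (rule is_BM_continuous_on_heat[OF Xp g])
    show "continuous_on {0..} (\<lambda>s. 1 / 2 * heat ?g1 s x)" "continuous_on {0..} (\<lambda>s. 1 / 4 * heat ?g2 s x)"
      by (intro continuous_intros is_BM_continuous_on_heat[OF Xp] g1 g2)+
    show "\<bar>heat g s x\<bar> \<le> ?K" if "0 \<le> s" for s
      using b0[OF that] nn by linarith
    show "\<bar>1 / 2 * heat ?g1 s x\<bar> \<le> ?K" if "0 \<le> s" for s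
      using b1[OF that] nn by linarith
    show "\<bar>1 / 4 * heat ?g2 s x\<bar> \<le> ?K" if "0 \<le> s" for s
      using b2[OF that] nn by linarith
    show "((\<lambda>s. heat g s x) has_real_derivative 1 / 2 * heat ?g1 s x) (at s)" if "0 < s" for s
      by (rule has_real_derivative_heat[OF g that])
    show "((\<lambda>s. 1 / 2 * heat ?g1 s x) has_real_derivative 1 / 4 * heat ?g2 s x) (at s)" if "0 < s" for s
      using DERIV_cmult[OF has_real_derivative_heat[OF g1 that, of x], of "1 / 2"] by simp
  qed
  also have "(\<integral>s. (1 / 4 * heat ?g2 \<bar>s\<bar> x) * gauss_dens t s \<partial>lborel) = 1 / 4 * U ?g2 t x"
    by (simp only: mult.assoc integral_mult_right_zero U_eq_integral[OF g2 t])
  also have "heat ?g1 0 x = ?g1 x"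
    by (simp add: heat_def)
  also have "gauss_dens t (0::real) = 1 / sqrt (2 * pi * t)"
    using t by (simp add: gauss_dens_def powr_minus powr_half_sqrt inverse_eq_divide)
  finally show ?thesis
    using der by (simp add: mult_ac)
qed

section \<open>Smoothness in space-time\<close>

text \<open>By the evolution equation, this class is closed under partial derivatives, in time as well.\<close>
inductive evol :: "(real \<times> 'b \<Rightarrow> real) \<Rightarrow> bool" where
  evol_U: "Cb_inf g \<Longrightarrow> evol (\<lambda>p. c * U g (fst p) (snd p))"
| evol_powr: "Cb_inf g \<Longrightarrow> evol (\<lambda>p. c * fst p powr a * g (snd p))"
| evol_add: "evol v \<Longrightarrow> evol w \<Longrightarrow> evol (\<lambda>p. v p + w p)"

text \<open>Positive times, because the exponents of the powers of t may be negative.\<close>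

lemma evol_continuous_on: "evol w \<Longrightarrow> continuous_on ({0<..} \<times> UNIV) w"
proof (induction rule: evol.induct)
  case (evol_U g c)
  then show ?case
    by (intro continuous_intros continuous_on_subset[OF continuous_on_U]) auto
next
  case (evol_powr g c a)
  then show ?case
    by (intro continuous_intros continuous_on_compose2[OF Cb_inf_continuous_on[of g UNIV]]) auto
qed (auto intro: continuous_on_add)

text \<open>A time derivative turns a \<open>U\<close>-term into a \<open>U\<close>-term plus a
  multiple of t^(-1/2) times a bounded smooth function of x, and it lowers the exponent of a power
  term by one. A spatial derivative acts on \<open>g\<close> alone. The constant \<open>c\<close> in
  the constructors collects the resulting factors.\<close>

lemma evol_has_derivative:
  assumes "evol w" "v \<in> Basis"
  shows "\<exists>w'. evol w' \<and> (\<forall>p\<in>{0<..} \<times> UNIV. ((\<lambda>s. w (p + s *\<^sub>R v)) has_real_derivative w' p) (at 0))"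
  using assms
proof (induction rule: evol.induct)
  case (evol_U g c)
  note g = evol_U.hyps
  consider "v = (1, 0)" | b where "v = (0, b)" "b \<in> Basis"
    using evol_U.prems by (auto simp: Basis_prod_def)
  then show ?case
  proof cases
    case 1
    \<comment> \<open>The inhomogeneous term is rewritten as a power of t: 1/(2 sqrt(2 pi t)) =
      t^(-1/2) / (2 sqrt(2 pi)).\<close>
    let ?w' = "\<lambda>p. (c / 8) * U (laplacian (laplacian g)) (fst p) (snd p) +
      (c / (2 * sqrt (2 * pi))) * fst p powr (- 1 / 2) * laplacian g (snd p)"
    have "evol ?w'"
      by (intro evol.intros Cb_inf_laplacian g)
    moreover have "((\<lambda>s. c * U g (fst (p + s *\<^sub>R v)) (snd (p + s *\<^sub>R v))) has_real_derivative ?w' p) (at 0)"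
      if "p \<in> {0<..} \<times> UNIV" for p
    proof -
      have t: "0 < fst p" using that by auto
      have "((\<lambda>t. c * U g t (snd p)) has_real_derivative ?w' p) (at (fst p))"
        by (rule DERIV_cong[OF DERIV_cmult[OF has_real_derivative_U_time[OF g t]]])
          (use t in \<open>simp add: powr_minus powr_half_sqrt real_sqrt_mult field_simps\<close>)
      then show ?thesis
        using DERIV_shift[of "\<lambda>t. c * U g t (snd p)" "?w' p" 0 "fst p"] 1 by (simp add: add.commute)
    qed
    ultimately show ?thesis by blast
  next
    case (2 b)
    let ?w' = "\<lambda>p. c * U (dd g b) (fst p) (snd p)"
    have "evol ?w'"
      by (intro evol.intros Cb_inf_dd g 2)
    moreover have "((\<lambda>s. c * U g (fst (p + s *\<^sub>R v)) (snd (p + s *\<^sub>R v))) has_real_derivative ?w' p) (at 0)"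
      if "p \<in> {0<..} \<times> UNIV" for p
      using DERIV_cmult[OF has_real_derivative_U_space[OF g 2(2), of "fst p" "snd p"], of c] that 2 by auto
    ultimately show ?thesis by blast
  qed
next
  case (evol_powr g c a)
  note g = evol_powr.hyps
  consider "v = (1, 0)" | b where "v = (0, b)" "b \<in> Basis"
    using evol_powr.prems by (auto simp: Basis_prod_def)
  then show ?case
  proof cases
    case 1
    let ?w' = "\<lambda>p. (c * a) * fst p powr (a - 1) * g (snd p)"
    have "evol ?w'"
      by (intro evol.intros g)
    moreover have "((\<lambda>s. c * fst (p + s *\<^sub>R v) powr a * g (snd (p + s *\<^sub>R v))) has_real_derivative ?w' p) (at 0)"
      if "p \<in> {0<..} \<times> UNIV" for p
    proof -
      have t: "0 < fst p" using that by auto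
      have "((\<lambda>t. c * t powr a * g (snd p)) has_real_derivative ?w' p) (at (fst p))"
        using t by (auto intro!: derivative_eq_intros)
      then show ?thesis
        using DERIV_shift[of "\<lambda>t. c * t powr a * g (snd p)" "?w' p" 0 "fst p"] 1
        by (simp add: add.commute)
    qed
    ultimately show ?thesis by blast
  next
    case (2 b)
    let ?w' = "\<lambda>p. c * fst p powr a * dd g b (snd p)"
    have "evol ?w'"
      by (intro evol.intros Cb_inf_dd g 2)
    moreover have "((\<lambda>s. c * fst (p + s *\<^sub>R v) powr a * g (snd (p + s *\<^sub>R v))) has_real_derivative ?w' p) (at 0)"
      if "p \<in> {0<..} \<times> UNIV" for p
      using DERIV_cmult[OF Cb_inf_has_real_derivative[OF g 2(2), of "snd p"], of "c * fst p powr a"] 2 by simp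
    ultimately show ?thesis by blast
  qed
next
  case (evol_add v' w)
  then obtain dv dw where "evol dv" "evol dw"
    and "\<forall>p\<in>{0<..} \<times> UNIV. ((\<lambda>s. v' (p + s *\<^sub>R v)) has_real_derivative dv p) (at 0)"
    and "\<forall>p\<in>{0<..} \<times> UNIV. ((\<lambda>s. w (p + s *\<^sub>R v)) has_real_derivative dw p) (at 0)"
    by metis
  then show ?case
    by (intro exI[of _ "\<lambda>p. dv p + dw p"]) (auto intro: evol.evol_add DERIV_add)
qed

end

text \<open>\<open>P\<close> acts as an invariant under differentiation. Iterated derivatives are
  controlled on \<open>U\<close> alone, and openness of \<open>U\<close> keeps small displacements
  along \<open>v\<close> inside it, so agreement on \<open>U\<close> suffices to transfer
  derivatives.\<close>

lemma smooth_onI_derivative_closed: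
  fixes u :: "'e::euclidean_space \<Rightarrow> real"
  assumes U: "open U" and u: "P u"
    and cont: "\<And>w. P w \<Longrightarrow> continuous_on U w"
    and deriv: "\<And>w v. P w \<Longrightarrow> v \<in> Basis \<Longrightarrow>
      \<exists>w'. P w' \<and> (\<forall>p\<in>U. ((\<lambda>s. w (p + s *\<^sub>R v)) has_real_derivative w' p) (at 0))"
  shows "smooth_on U u"
proof -
  have transfer: "((\<lambda>s. h (p + s *\<^sub>R v)) has_real_derivative D) (at 0)"
    if "((\<lambda>s. w (p + s *\<^sub>R v)) has_real_derivative D) (at 0)" "\<forall>p\<in>U. h p = w p" "p \<in> U" for h w p v D
  proof (rule has_field_derivative_transform_within_open[OF that(1)])
    show "open ((\<lambda>s. p + s *\<^sub>R v) -` U)"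
      by (intro open_vimage U continuous_intros)
  qed (use that in auto)
  have ex: "\<exists>w. P w \<and> (\<forall>p\<in>U. pd_iter vs u p = w p)" if "set vs \<subseteq> Basis" for vs
    using that
  proof (induction vs)
    case Nil
    then show ?case using u by auto
  next
    case (Cons v vs)
    then obtain w where w: "P w" "\<forall>p\<in>U. pd_iter vs u p = w p" by auto
    obtain w' where w': "P w'" "\<forall>p\<in>U. ((\<lambda>s. w (p + s *\<^sub>R v)) has_real_derivative w' p) (at 0)"
      using deriv[OF w(1), of v] Cons.prems by auto
    have "pd_iter (v # vs) u p = w' p" if "p \<in> U" for p
      using transfer[OF _ w(2) that, of v "w' p"] w'(2) that by (simp add: dd_def DERIV_imp_deriv)
    with w'(1) show ?case by blast
  qed
  show ?thesis
    unfolding smooth_on_def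
  proof (intro allI impI conjI ballI)
    fix vs :: "'e list" assume "set vs \<subseteq> Basis"
    then obtain w where w: "P w" "\<forall>p\<in>U. pd_iter vs u p = w p" using ex by blast
    show "continuous_on U (pd_iter vs u)"
      using cont[OF w(1)] w(2) by (simp cong: continuous_on_cong)
    fix v x assume vx: "v \<in> (Basis :: 'e set)" "x \<in> U"
    obtain D where "((\<lambda>s. w (x + s *\<^sub>R v)) has_real_derivative D) (at 0)"
      using deriv[OF w(1) vx(1)] vx(2) by blast
    from transfer[OF this w(2) vx(2)] show "(\<lambda>s. pd_iter vs u (x + s *\<^sub>R v)) differentiable (at 0)"
      by (auto simp: real_differentiable_def)
  qed
qed

theorem theorem1p1:
  fixes M :: "'a measure"
    and Xp Xm :: "real \<Rightarrow> 'a \<Rightarrow> real ^ 'n"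
    and Y :: "real \<Rightarrow> 'a \<Rightarrow> real"
    and f :: "real ^ 'n \<Rightarrow> real"
    and u :: "real \<times> (real ^ 'n) \<Rightarrow> real"
  assumes "prob_space M"
    and "is_BM M Xp" and "is_BM M Xm" and "is_BM M Y"
    and "prob_space.indep_sets M
           (\<lambda>i::nat. if i = 0 then proc_sigma M Xp else if i = 1 then proc_sigma M Xm
                     else proc_sigma M Y) {0, 1, 2}"
    and "Cb_inf f"
    and u_def: "\<And>t x. u (t, x) = prob_space.expectation M (\<lambda>\<omega>. f (IBM Xp Xm Y x t \<omega>))"
  shows "smooth_on ({0<..} \<times> UNIV) u
       \<and> continuous_on ({0..} \<times> UNIV) u
       \<and> bounded (u ` ({0..} \<times> UNIV))
       \<and> (\<forall>t>0. \<forall>x. (1/8) * laplacian (laplacian (\<lambda>y. u (t, y))) x - deriv (\<lambda>s. u (s, x)) t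
                      = - (1/2) * (1 / sqrt (2 * pi * t)) * laplacian f x)
       \<and> (\<forall>x. u (0, x) = f x)"
proof -
  interpret prob_space M by fact
  have events: "proc_sigma M Xp \<subseteq> events" "proc_sigma M Xm \<subseteq> events" "proc_sigma M Y \<subseteq> events"
    using assms(5) by (auto simp: indep_sets_def)
  \<comment> \<open>The product rule for the subfamily with indices 0 (\<open>Xp\<close>) and 2
    (\<open>Y\<close>).\<close>
  have "prob (a \<inter> b) = prob a * prob b" if "a \<in> proc_sigma M Xp" "b \<in> proc_sigma M Y" for a b
    using indep_setsD[OF assms(5), of "{0, 2}" "\<lambda>i. if i = 0 then a else b"] that
    by (simp add: Int_commute)
  then have indep_Xp: "indep_set (proc_sigma M Xp) (proc_sigma M Y)"
    using events by (simp add: indep_sets2_eq)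
  have "prob (a \<inter> b) = prob a * prob b" if "a \<in> proc_sigma M Xm" "b \<in> proc_sigma M Y" for a b
    using indep_setsD[OF assms(5), of "{1, 2}" "\<lambda>i. if i = 1 then a else b"] that
    by (simp add: Int_commute)
  then have indep_Xm: "indep_set (proc_sigma M Xm) (proc_sigma M Y)"
    using events by (simp add: indep_sets2_eq)
  interpret iterated_BM M Xp Xm Y
    by unfold_locales (use assms indep_Xp indep_Xm in auto)
  note f = \<open>Cb_inf f\<close>
  have u_U: "u (t, x) = U f t x" for t x
    by (simp add: u_def U_def Z_def IBM_def)
  then have u: "u = (\<lambda>p. U f (fst p) (snd p))"
    by (intro ext) (metis prod.collapse)
  obtain K where K: "\<And>x. \<bar>f x\<bar> \<le> K" using Cb_inf_bounded[OF f] by blast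
  have "evol u"
    using evol_U[OF f, of 1] by (simp add: u)
  then have "smooth_on ({0<..} \<times> UNIV) u"
    by (intro smooth_onI_derivative_closed[where P = evol] open_Times evol_continuous_on
        evol_has_derivative) auto
  moreover have "continuous_on ({0..} \<times> UNIV) u"
    unfolding u by (rule continuous_on_U[OF f])
  moreover have "bounded (u ` ({0..} \<times> UNIV))"
    using U_bounded[OF f K] by (auto simp: bounded_iff u)
  \<comment> \<open>Both Laplacians commute with \<open>U\<close>, so the fourth-order term cancels
    against the one in the time derivative and the boundary term remains.\<close>
  moreover have "(1/8) * laplacian (laplacian (\<lambda>y. u (t, y))) x - deriv (\<lambda>s. u (s, x)) t
      = - (1/2) * (1 / sqrt (2 * pi * t)) * laplacian f x" if "0 < t" for t x
    using DERIV_imp_deriv[OF has_real_derivative_U_time[OF f that, of x]] that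
    by (simp add: u_U laplacian_U Cb_inf_laplacian f)
  moreover have "u (0, x) = f x" for x
    by (simp add: u_U U_0)
  ultimately show ?thesis by blast
qed

end
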